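(* Let $\mathbb{T}$ be a time scale, let $\alpha\in[0,1]$, let $\kappa_0,\kappa_1$ be an admissible pair on $\mathbb{T}$, and let $\Delta^{\alpha}f(t)=\kappa_1(\alpha,t)f(t)+\kappa_0(\alpha,t)f^{\Delta}(t)$ for $\Delta$-differentiable $f$. Let $p:\mathbb{T}\to\mathbb{R}$ be rd-continuous with $1+\mu(t)\frac{p(t)-\kappa_1(\alpha,t)}{\kappa_0(\alpha,t)}\neq0$ for all $t\in\mathbb{T}^{\kappa}$ (a condition read for $\alpha\in(0,1]$, where $\kappa_0\neq0$). Assume the functions $f$ and $g$ are $\Delta$-differentiable, as needed. Then: (i) $\Delta^{\alpha}(af+bg)=a\Delta^{\alpha}(f)+b\Delta^{\alpha}(g)$ for all $a,b\in\mathbb{R}$; (ii) $\Delta^{\alpha}c=c\,\kappa_1(\alpha,\cdot)$ for all constants $c\in\mathbb{R}$; (iii) $\Delta^{\alpha}(fg)=f\Delta^{\alpha}(g)+g^{\sigma}\Delta^{\alpha}(f)-fg^{\sigma}\kappa_1(\alpha,\cdot)$; (iv) $\Delta^{\alpha}\left(\frac{f}{g}\right)=\frac{g\Delta^{\alpha}(f)-f\Delta^{\alpha}(g)}{gg^{\sigma}}+\frac{f}{g}\kappa_1(\alpha,\cdot)$ (where $gg^\sigma\neq0$); (v) $\Delta^{\alpha}E_p(t,s)=p(t)E_p(t,s)$ for all $\alpha\in(0,1]$; (vi) $\Delta^{\alpha}\left(\int_a^t\frac{f(s)E_0(t,s)}{\kappa_0(\alpha,s)}\,\Delta s\right)=f(t)E_0(\sigma(t),t)$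 for all $\alpha\in(0,1]$. In (v) and (vi), $\Delta^{\alpha}$ acts on the variable $t$.
   Context: A time scale $\mathbb{T}$ is a nonempty closed subset of $\mathbb{R}$, with forward jump $\sigma(t)=\inf\{s\in\mathbb{T}:s>t\}$, backward jump $\rho(t)=\sup\{s\in\mathbb{T}:s<t\}$ (usual conventions $\inf\emptyset=\sup\mathbb{T}$, $\sup\emptyset=\inf\mathbb{T}$) and graininess $\mu(t)=\sigma(t)-t$; $f^\sigma=f\circ\sigma$. A point $t$ is right-dense if $t<\sup\mathbb{T}$ and $\sigma(t)=t$, left-dense if $t>\inf\mathbb{T}$ and $\rho(t)=t$, left-scattered if $\rho(t)<t$. $\mathbb{T}^{\kappa}=\mathbb{T}\setminus\{m\}$ if $\mathbb{T}$ has a left-scattered maximum $m$, and $\mathbb{T}^{\kappa}=\mathbb{T}$ otherwise. Delta derivative: for $t\in\mathbb{T}^\kappa$, $f^{\Delta}(t)$ is the number (if it exists) such that for every $\epsilon>0$ there is $\delta>0$ with $|[f(\sigma(t))-f(s)]-f^{\Delta}(t)[\sigma(t)-s]|\le\epsilon|\sigma(t)-s|$ for all $s\in(t-\delta,t+\delta)\cap\mathbb{T}$. $\int_a^t h(s)\Delta s$ is the standard delta integral of time-scale calculus. A function on $\mathbb{T}$ is rd-continuous if it is continuous at right-dense points and has finite left-sided limits at left-dense points. A function $k:[0,1]\times\mathbb{T}\to[0,\infty)$ is rd-continuous if $k(\alpha,\cdot)$ is rd-continuous for every $\alpha\in[0,1]$ and $k(\cdot,t)$ is continuous on $[0,1]$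 for every $t\in\mathbb{T}$. Admissible pair: rd-continuous $\kappa_0,\kappa_1:[0,1]\times\mathbb{T}\to[0,\infty)$ such that for all $t\in\mathbb{T}$: $\lim_{\alpha\to0^+}\kappa_1(\alpha,t)=1$, $\lim_{\alpha\to0^+}\kappa_0(\alpha,t)=0$, $\lim_{\alpha\to1^-}\kappa_1(\alpha,t)=0$, $\lim_{\alpha\to1^-}\kappa_0(\alpha,t)=1$, $\kappa_1(\alpha,t)\ne0$ for $\alpha\in[0,1)$, $\kappa_0(\alpha,t)\neq0$ for $\alpha\in(0,1]$. Exponentials: $e_q(t,s)=\exp\left(\int_s^t\xi_{\mu(\tau)}(q(\tau))\Delta\tau\right)$ denotes the usual exponential function on the time scale, with $\xi_h(z)=\frac1h\mathrm{Log}(1+hz)$ for $h>0$ ($\mathrm{Log}$ the principal logarithm) and $\xi_0(z)=z$. For $\alpha\in(0,1]$, $s,t\in\mathbb{T}$ with $s\le t$, and rd-continuous $p:\mathbb{T}\to\mathbb{R}$ with $1+\mu(t)\frac{p(t)-\kappa_1(\alpha,t)}{\kappa_0(\alpha,t)}\neq0$ for all $t\in\mathbb{T}^{\kappa}$, the conformable exponential is $E_p(t,s)=e_q(t,s)$ with $q=\frac{p-\kappa_1(\alpha,\cdot)}{\kappa_0(\alpha,\cdot)}$; $E_0$ is the case $p\equiv0$ (defined under the same condition with $p\equiv0$).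
   Formalization: In (v) the quotient (p−κ₁)/κ₀, and in (vi) −κ₁/κ₀ and f/κ₀, are assumed rd-continuous, and continuous at t when t is the maximum of the time scale; without this the exponential or integral may not exist, or the formula fails at a left-dense maximum. *)

theory Defs
  imports "HOL-Analysis.Analysis"
begin

text \<open>
  Functions on a time scale \<open>T\<close> are total functions on the reals of which only the values on \<open>T\<close>
  are ever used.
\<close>

definition time_scale :: "real set \<Rightarrow> bool" where
  "time_scale T \<longleftrightarrow> T \<noteq> {} \<and> closed T"

definition fwd_jump :: "real set \<Rightarrow> real \<Rightarrow> real" where
  "fwd_jump T t = (if {s \<in> T. t < s} = {} then Sup T else Inf {s \<in> T. t < s})"

definition bwd_jump :: "real set \<Rightarrow> real \<Rightarrow> real" where
  "bwd_jump T t = (if {s \<in> T. s < t} = {} then Inf T else Sup {s \<in> T. s < t})"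

definition graininess :: "real set \<Rightarrow> real \<Rightarrow> real" where
  "graininess T t = fwd_jump T t - t"

text \<open>
  The conditions \<open>t < sup T\<close> and \<open>t > inf T\<close> are written with an existential quantifier, because
  the supremum and infimum may be infinite. In particular a maximum of \<open>T\<close> is never right-dense.
\<close>

definition right_dense :: "real set \<Rightarrow> real \<Rightarrow> bool" where
  "right_dense T t \<longleftrightarrow> (\<exists>s\<in>T. t < s) \<and> fwd_jump T t = t"

definition left_dense :: "real set \<Rightarrow> real \<Rightarrow> bool" where
  "left_dense T t \<longleftrightarrow> (\<exists>s\<in>T. s < t) \<and> bwd_jump T t = t"

definition right_scattered :: "real set \<Rightarrow> real \<Rightarrow> bool" where
  "right_scattered T t \<longleftrightarrow> t < fwd_jump T t"

definition left_scattered :: "real set \<Rightarrow> real \<Rightarrow> bool" where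
  "left_scattered T t \<longleftrightarrow> bwd_jump T t < t"

definition is_maximum :: "real set \<Rightarrow> real \<Rightarrow> bool" where
  "is_maximum T t \<longleftrightarrow> t \<in> T \<and> (\<forall>s\<in>T. s \<le> t)"

definition ts_kappa :: "real set \<Rightarrow> real set" where
  "ts_kappa T = T - {m. is_maximum T m \<and> left_scattered T m}"

definition has_delta_derivative ::
  "real set \<Rightarrow> (real \<Rightarrow> 'a::real_normed_vector) \<Rightarrow> 'a \<Rightarrow> real \<Rightarrow> bool" where
  "has_delta_derivative T f D t \<longleftrightarrow>
     (\<forall>\<epsilon>>0. \<exists>\<delta>>0. \<forall>s \<in> {t - \<delta><..<t + \<delta>} \<inter> T.
        norm ((f (fwd_jump T t) - f s) - (fwd_jump T t - s) *\<^sub>R D) \<le> \<epsilon> * \<bar>fwd_jump T t - s\<bar>)"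

definition rd_continuous :: "real set \<Rightarrow> (real \<Rightarrow> 'a::real_normed_vector) \<Rightarrow> bool" where
  "rd_continuous T f \<longleftrightarrow>
     (\<forall>t\<in>T. right_dense T t \<longrightarrow> continuous (at t within T) f) \<and>
     (\<forall>t\<in>T. left_dense T t \<longrightarrow> (\<exists>L. (f \<longlongrightarrow> L) (at t within (T \<inter> {..<t}))))"

text \<open>
  The Cauchy delta integral of Bohner and Peterson: \<open>F\<close> is a pre-antiderivative of \<open>h\<close> if it is
  continuous and there is a region of differentiation \<open>D\<close>, omitting at most countably many points
  and no right-scattered one, on which the delta derivative of \<open>F\<close> is \<open>h\<close>. The exceptional set
  cannot be dropped: an rd-continuous \<open>h\<close> may be discontinuous at a left-dense maximum of \<open>T\<close>,
  where no \<open>F\<close> has derivative \<open>h\<close>.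
\<close>

definition pre_antiderivative ::
  "real set \<Rightarrow> (real \<Rightarrow> 'a::real_normed_vector) \<Rightarrow> (real \<Rightarrow> 'a) \<Rightarrow> bool" where
  "pre_antiderivative T h F \<longleftrightarrow> continuous_on T F \<and>
     (\<exists>D \<subseteq> ts_kappa T. countable (ts_kappa T - D) \<and>
        (\<forall>t \<in> ts_kappa T - D. \<not> right_scattered T t) \<and>
        (\<forall>t\<in>D. has_delta_derivative T F (h t) t))"

definition delta_integral ::
  "real set \<Rightarrow> (real \<Rightarrow> 'a::real_normed_vector) \<Rightarrow> real \<Rightarrow> real \<Rightarrow> 'a" where
  "delta_integral T h a b = (THE I. \<exists>F. pre_antiderivative T h F \<and> I = F b - F a)"

definition cylinder :: "real \<Rightarrow> complex \<Rightarrow> complex" where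
  "cylinder h z = (if h = 0 then z else Ln (1 + of_real h * z) / of_real h)"

text \<open>
  The exponential is complex-valued, since the principal logarithm of \<open>1 + \<mu> q\<close> is not real when
  \<open>1 + \<mu> q < 0\<close>.
\<close>

definition ts_exp :: "real set \<Rightarrow> (real \<Rightarrow> real) \<Rightarrow> real \<Rightarrow> real \<Rightarrow> complex" where
  "ts_exp T q t s =
     exp (delta_integral T (\<lambda>\<tau>. cylinder (graininess T \<tau>) (complex_of_real (q \<tau>))) s t)"

text \<open>
  In the following, \<open>k0 \<alpha> t\<close> and \<open>k1 \<alpha> t\<close> stand for \<open>\<kappa>\<^sub>0(\<alpha>, t)\<close> and \<open>\<kappa>\<^sub>1(\<alpha>, t)\<close>.
\<close>

definition rd_continuous_family :: "real set \<Rightarrow> (real \<Rightarrow> real \<Rightarrow> real) \<Rightarrow> bool" where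
  "rd_continuous_family T k \<longleftrightarrow>
     (\<forall>\<alpha>\<in>{0..1}. rd_continuous T (k \<alpha>)) \<and> (\<forall>t\<in>T. continuous_on {0..1} (\<lambda>\<alpha>. k \<alpha> t))"

definition admissible_pair ::
  "real set \<Rightarrow> (real \<Rightarrow> real \<Rightarrow> real) \<Rightarrow> (real \<Rightarrow> real \<Rightarrow> real) \<Rightarrow> bool" where
  "admissible_pair T k0 k1 \<longleftrightarrow>
     (\<forall>\<alpha>\<in>{0..1}. \<forall>t\<in>T. 0 \<le> k0 \<alpha> t \<and> 0 \<le> k1 \<alpha> t) \<and>
     rd_continuous_family T k0 \<and> rd_continuous_family T k1 \<and>
     (\<forall>t\<in>T.
        ((\<lambda>\<alpha>. k1 \<alpha> t) \<longlongrightarrow> 1) (at_right 0) \<and> ((\<lambda>\<alpha>. k0 \<alpha> t) \<longlongrightarrow> 0) (at_right 0) \<and>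
        ((\<lambda>\<alpha>. k1 \<alpha> t) \<longlongrightarrow> 0) (at_left 1) \<and> ((\<lambda>\<alpha>. k0 \<alpha> t) \<longlongrightarrow> 1) (at_left 1) \<and>
        (\<forall>\<alpha>\<in>{0..<1}. k1 \<alpha> t \<noteq> 0) \<and> (\<forall>\<alpha>\<in>{0<..1}. k0 \<alpha> t \<noteq> 0))"

text \<open>
  For \<open>k0\<close>, \<open>k1\<close>, \<open>p\<close> rd-continuous and \<open>k0 \<alpha> t \<noteq> 0\<close> the following quotient need not be
  rd-continuous: \<open>k0 \<alpha>\<close> may have left limit 0 at a left-dense, right-scattered point, and then
  the integral in the exponential may diverge.
\<close>

definition conf_quotient ::
  "(real \<Rightarrow> real \<Rightarrow> real) \<Rightarrow> (real \<Rightarrow> real \<Rightarrow> real) \<Rightarrow> real \<Rightarrow> (real \<Rightarrow> real) \<Rightarrow> real \<Rightarrow> real" where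
  "conf_quotient k0 k1 \<alpha> p t = (p t - k1 \<alpha> t) / k0 \<alpha> t"

definition conf_exp ::
  "real set \<Rightarrow> (real \<Rightarrow> real \<Rightarrow> real) \<Rightarrow> (real \<Rightarrow> real \<Rightarrow> real) \<Rightarrow> real \<Rightarrow> (real \<Rightarrow> real) \<Rightarrow>
   real \<Rightarrow> real \<Rightarrow> complex" where
  "conf_exp T k0 k1 \<alpha> p t s = ts_exp T (conf_quotient k0 k1 \<alpha> p) t s"

text \<open>
  \<open>has_conf_derivative T k0 k1 \<alpha> f D t\<close> says that \<open>f\<close> is delta differentiable at \<open>t\<close> and that
  the conformable derivative of \<open>f\<close> at \<open>t\<close> is \<open>D\<close>. The relational form is used because the delta
  derivative is unique only if \<open>T\<close> has more than one point (lemma \<open>has_delta_derivative_unique\<close>).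
\<close>

definition has_conf_derivative ::
  "real set \<Rightarrow> (real \<Rightarrow> real \<Rightarrow> real) \<Rightarrow> (real \<Rightarrow> real \<Rightarrow> real) \<Rightarrow> real \<Rightarrow>
   (real \<Rightarrow> 'a::real_normed_vector) \<Rightarrow> 'a \<Rightarrow> real \<Rightarrow> bool" where
  "has_conf_derivative T k0 k1 \<alpha> f D t \<longleftrightarrow>
     (\<exists>d. has_delta_derivative T f d t \<and> D = k1 \<alpha> t *\<^sub>R f t + k0 \<alpha> t *\<^sub>R d)"

lemma kappa_limit_point:
  assumes "time_scale T" "T \<noteq> {t}" "t \<in> ts_kappa T" "\<delta> > 0"
  shows "\<exists>s \<in> {t - \<delta><..<t + \<delta>} \<inter> T. fwd_jump T t - s \<noteq> 0"
proof (cases "fwd_jump T t = t")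
  case False
  with assms show ?thesis by (intro bexI[of _ t]) (auto simp: ts_kappa_def)
next
  case True
  have tT: "t \<in> T" using assms by (auto simp: ts_kappa_def)
  show ?thesis
  proof (cases "{s \<in> T. t < s} = {}")
    case False
    have "Inf {s \<in> T. t < s} < t + \<delta>"
      using True False assms(4) unfolding fwd_jump_def by (simp split: if_splits)
    then obtain s where "s \<in> T" "t < s" "s < t + \<delta>"
      using cInf_lessD[OF False] by auto
    then show ?thesis using True assms(4) by (intro bexI[of _ s]) auto
  next
    case max: True
    have ne: "{s \<in> T. s < t} \<noteq> {}"
    proof -
      obtain s where "s \<in> T" "s \<noteq> t" using assms(1,2) tT by (auto simp: time_scale_def)
      moreover from this have "s < t" using max by force
      ultimately show ?thesis by auto
    qed
    have "is_maximum T t" using tT max by (force simp: is_maximum_def)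
    then have "t \<le> bwd_jump T t" using assms(3) by (auto simp: ts_kappa_def left_scattered_def)
    then have "t - \<delta> < Sup {s \<in> T. s < t}"
      using ne assms(4) unfolding bwd_jump_def by (simp split: if_splits)
    then obtain s where "s \<in> T" "s < t" "t - \<delta> < s"
      using less_cSupD[OF ne] by auto
    then show ?thesis using True assms(4) by (intro bexI[of _ s]) auto
  qed
qed

lemma has_delta_derivative_unique:
  assumes T: "time_scale T" "T \<noteq> {t}" "t \<in> ts_kappa T"
    and D: "has_delta_derivative T f D t" "has_delta_derivative T f D' t"
  shows "D = D'"
proof (rule ccontr)
  assume "D \<noteq> D'"
  then have e: "norm (D - D') / 3 > 0" (is "?e > 0") by simp
  obtain d where d: "d > 0" "\<forall>s \<in> {t - d<..<t + d} \<inter> T.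
      norm ((f (fwd_jump T t) - f s) - (fwd_jump T t - s) *\<^sub>R D) \<le> ?e * \<bar>fwd_jump T t - s\<bar>"
    using D(1) e unfolding has_delta_derivative_def by blast
  obtain d' where d': "d' > 0" "\<forall>s \<in> {t - d'<..<t + d'} \<inter> T.
      norm ((f (fwd_jump T t) - f s) - (fwd_jump T t - s) *\<^sub>R D') \<le> ?e * \<bar>fwd_jump T t - s\<bar>"
    using D(2) e unfolding has_delta_derivative_def by blast
  obtain s where s: "s \<in> {t - min d d'<..<t + min d d'} \<inter> T" "fwd_jump T t - s \<noteq> 0"
    using kappa_limit_point[OF T, of "min d d'"] d(1) d'(1) by auto
  let ?x = "fwd_jump T t - s" and ?y = "f (fwd_jump T t) - f s"
  have sd: "s \<in> {t - d<..<t + d} \<inter> T" "s \<in> {t - d'<..<t + d'} \<inter> T" using s(1) by auto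
  note 1 = d(2)[rule_format, OF sd(1)] and 2 = d'(2)[rule_format, OF sd(2)]
  have "\<bar>?x\<bar> * norm (D - D') = norm ((?y - ?x *\<^sub>R D') - (?y - ?x *\<^sub>R D))"
    by (simp add: scaleR_diff_right flip: norm_scaleR)
  also have "\<dots> \<le> ?e * \<bar>?x\<bar> + ?e * \<bar>?x\<bar>"
    using norm_triangle_ineq4[of "?y - ?x *\<^sub>R D'" "?y - ?x *\<^sub>R D"] 1 2 by linarith
  also have "\<dots> = \<bar>?x\<bar> * norm (D - D') * (2/3)" by simp
  finally have "\<bar>?x\<bar> * norm (D - D') \<le> 0" by linarith
  moreover have "\<bar>?x\<bar> * norm (D - D') > 0" using s(2) \<open>D \<noteq> D'\<close> by simp
  ultimately show False by linarith
qed

end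

theory Submission
  imports Defs
begin

text \<open>
  The algebraic rules hold because a delta derivative is either an ordinary derivative relative to \<open>T\<close>,
  where the forward jump fixes \<open>t\<close>, or a difference quotient over a gap
  (\<open>has_delta_derivative_fixed_iff\<close>, \<open>has_delta_derivative_scattered_iff\<close>); in both cases linearity, the
  product rule and the quotient rule are elementary, and the conformable rules are linear combinations.

  The other two rules need the delta integral to be what its definition intends. Existence
  (\<open>rd_continuous_antiderivative\<close>): extend an rd-continuous function to the real line so that it is constant
  on the gaps of \<open>T\<close>. The extension has one-sided limits everywhere, hence is integrable, and its indefinite
  integral is an antiderivative, the only possible exception being a maximum of \<open>T\<close>. Uniqueness
  (\<open>delta_integral_eq\<close>): a continuous function on \<open>T\<close> whose delta derivative vanishes outside a countable
  set without right-scattered points is constant, by a mean value inequality.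

  For \<open>q\<close> rd-continuous the cylinder transform of \<open>q\<close> is rd-continuous. With an antiderivative
  \<open>F\<close> of it, the exponential is \<open>e\<^sub>q(r, s) = exp (F r) exp (- F s)\<close>, and \<open>exp (F r)\<close> has delta derivative
  \<open>q exp (F r)\<close> where \<open>1 + \<mu> q \<noteq> 0\<close> (\<open>ts_exp_factorization\<close>). For \<open>q = (p - k1) / k0\<close> the conformable derivative of the
  exponential is \<open>k1 + k0 q = p\<close> times the exponential. For \<open>p = 0\<close>, let \<open>G\<close> be an antiderivative of
  \<open>f / k0 exp (- F)\<close>. The integral of \<open>f(s) E\<^sub>0(r, s) / k0(s)\<close> from \<open>a\<close> to \<open>r\<close> is then \<open>(G r - G a) exp (F r)\<close>,
  and the product rule gives two terms: \<open>k0\<close> times the one with the derivative of \<open>exp (F r)\<close> cancels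
  \<open>k1\<close> times the function, and the other one is \<open>f(t) E\<^sub>0(\<sigma>(t), t)\<close>.
\<close>

section \<open>Jumps\<close>

lemma ts_kappaD: "t \<in> ts_kappa T \<Longrightarrow> t \<in> T"
  by (simp add: ts_kappa_def)

lemma fwd_jump_le:
  assumes "s \<in> T" "t < s"
  shows "fwd_jump T t \<le> s"
  using assms unfolding fwd_jump_def
  by (auto intro!: cInf_lower bdd_belowI[of _ t])

lemma fwd_jump_maximum:
  assumes "is_maximum T t"
  shows "fwd_jump T t = t"
proof -
  have "{s \<in> T. t < s} = {}" "Sup T = t"
    using assms by (auto simp: is_maximum_def intro: cSup_eq_maximum)
  then show ?thesis by (simp add: fwd_jump_def)
qed

lemma fwd_jump_ge:
  assumes "t \<in> T"
  shows "t \<le> fwd_jump T t"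
proof (cases "{s \<in> T. t < s} = {}")
  case True
  then have "is_maximum T t" using assms by (force simp: is_maximum_def)
  then show ?thesis by (simp add: fwd_jump_maximum)
next
  case False
  then show ?thesis unfolding fwd_jump_def by (auto intro!: cInf_greatest)
qed

lemma fwd_jump_in:
  assumes "time_scale T" "t \<in> T"
  shows "fwd_jump T t \<in> T"
proof (cases "{s \<in> T. t < s} = {}")
  case True
  then have "is_maximum T t" using assms by (force simp: is_maximum_def)
  then show ?thesis using assms by (simp add: fwd_jump_maximum)
next
  case False
  have "Inf {s \<in> T. t < s} \<in> closure {s \<in> T. t < s}"
    using False by (intro closure_contains_Inf bdd_belowI[of _ t]) auto
  also have "\<dots> \<subseteq> T"
    using assms by (intro closure_minimal) (auto simp: time_scale_def)
  finally show ?thesis unfolding fwd_jump_def by (subst if_not_P[OF False])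
qed

lemma right_dense_point:
  assumes "right_dense T t" "t < u"
  obtains s where "s \<in> T" "t < s" "s < u"
proof -
  have ne: "{s \<in> T. t < s} \<noteq> {}" using assms by (auto simp: right_dense_def)
  then have "Inf {s \<in> T. t < s} < u"
    using assms by (auto simp: right_dense_def fwd_jump_def split: if_splits)
  then show ?thesis using cInf_lessD[OF ne] that by auto
qed

text \<open>
  The three cases in which the delta derivative behaves differently. A maximum has
  \<open>fwd_jump T t = t\<close> like a right-dense point, but rd-continuity says nothing about the value there.
\<close>

lemma point_kind:
  assumes "t \<in> T"
  obtains "right_scattered T t" | "right_dense T t" | "is_maximum T t"
  using assms fwd_jump_ge[OF assms]
  by (force simp: right_scattered_def right_dense_def is_maximum_def not_le)

lemma graininess_bounds:
  assumes "s \<in> T" "u \<in> T" "s < u"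
  shows "0 \<le> graininess T s" "graininess T s \<le> u - s"
  using fwd_jump_ge[OF assms(1)] fwd_jump_le[OF assms(2,3)] by (simp_all add: graininess_def)

text \<open>
  A point \<open>u\<close> of \<open>T\<close> slightly to the right of \<open>t\<close> bounds all jumps that start
  to the left of \<open>u\<close>, on either side of \<open>t\<close>.
\<close>

lemma graininess_tendsto_right_dense:
  assumes "right_dense T t"
  shows "(graininess T \<longlongrightarrow> 0) (at t within T)"
proof (rule tendstoI)
  fix e :: real assume "e > 0"
  then obtain u where u: "u \<in> T" "t < u" "u < t + e/2"
    using right_dense_point[OF assms, of "t + e/2"] by auto
  show "eventually (\<lambda>s. dist (graininess T s) 0 < e) (at t within T)"
    unfolding eventually_at
  proof (intro exI[of _ "u - t"] conjI ballI impI)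
    fix s assume s: "s \<in> T" "s \<noteq> t \<and> dist s t < u - t"
    then have "s < u" by (auto simp: dist_real_def)
    from graininess_bounds[OF s(1) u(1) this] s u
    show "dist (graininess T s) 0 < e" by (auto simp: dist_real_def abs_if split: if_splits)
  qed (use u in simp)
qed

text \<open>
  Here \<open>t\<close> itself bounds the jumps. This covers left-dense points, where only the points
  below \<open>t\<close> matter, and maxima, which have no others.
\<close>

lemma graininess_tendsto_from_left:
  assumes "t \<in> T" "A \<subseteq> T" "\<And>s. s \<in> A \<Longrightarrow> s \<le> t"
  shows "(graininess T \<longlongrightarrow> 0) (at t within A)"
proof (rule tendstoI)
  fix e :: real assume "e > 0"
  show "eventually (\<lambda>s. dist (graininess T s) 0 < e) (at t within A)"
    unfolding eventually_at
  proof (intro exI[of _ e] conjI ballI impI)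
    fix s assume s: "s \<in> A" "s \<noteq> t \<and> dist s t < e"
    then have "s < t" "s \<in> T" using assms by force+
    with graininess_bounds[of s T t] s assms
    show "dist (graininess T s) 0 < e" by (auto simp: dist_real_def)
  qed (use \<open>e > 0\<close> in simp)
qed

section \<open>Delta derivatives\<close>

text \<open>
  The delta derivative is of one of two well-known kinds. Where \<open>t\<close> is not right-scattered it is the
  ordinary derivative relative to \<open>T\<close>; at a right-scattered point it is the difference quotient over
  the gap, plus continuity. All differentiation rules follow from these two descriptions.
\<close>

lemma has_delta_derivative_fixed_iff:
  assumes "fwd_jump T t = t"
  shows "has_delta_derivative T f D t \<longleftrightarrow> (f has_vector_derivative D) (at t within T)"
proof -
  have eq: "norm (f t - f s - (t - s) *\<^sub>R D) = norm (f s - f t - (s - t) *\<^sub>R D)" for s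
    using norm_minus_cancel[of "f s - f t - (s - t) *\<^sub>R D"] by (simp add: algebra_simps)
  have ball: "(\<forall>s \<in> {t - d<..<t + d} \<inter> T. P s) \<longleftrightarrow> (\<forall>s \<in> T. norm (s - t) < d \<longrightarrow> P s)" for d P
    by (auto simp: abs_less_iff)
  show ?thesis
    unfolding has_delta_derivative_def has_vector_derivative_def has_derivative_within_alt assms ball
    by (simp add: eq bounded_linear_scaleR_left abs_minus_commute)
qed

lemma has_delta_derivative_scattered_iff:
  assumes t: "t \<in> T" and sc: "right_scattered T t"
  shows "has_delta_derivative T f D t \<longleftrightarrow>
    continuous (at t within T) f \<and> f (fwd_jump T t) = f t + graininess T t *\<^sub>R D"
    (is "?L \<longleftrightarrow> ?C \<and> ?J")
proof -
  define m where "m = graininess T t"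
  have m: "m > 0" "fwd_jump T t = t + m"
    using sc by (auto simp: m_def graininess_def right_scattered_def)
  have lin: "((\<lambda>s. (s - t) *\<^sub>R D) \<longlongrightarrow> 0) (at t within T)"
    by (auto intro!: tendsto_eq_intros)
  have near: "eventually (\<lambda>s. s \<in> {t - d<..<t + d} \<inter> T) (at t within T)" if "d > 0" for d
    using that by (auto simp: eventually_at dist_real_def intro!: exI[of _ d])
  show ?thesis
  proof
    assume L: ?L
    \<comment> \<open>At \<open>s = t\<close> the left side of the defining inequality is a fixed number, and the right side is
      as small as desired.\<close>
    have J: ?J
    proof (rule ccontr)
      assume "\<not> ?J"
      then have "norm (f (t + m) - f t - m *\<^sub>R D) > 0" (is "?n > 0")
        using m by (simp add: m_def algebra_simps)
      then obtain d where "d > 0" "\<forall>s \<in> {t - d<..<t + d} \<inter> T.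
        norm (f (t + m) - f s - (t + m - s) *\<^sub>R D) \<le> ?n / (2 * m) * \<bar>t + m - s\<bar>"
        using L[unfolded has_delta_derivative_def, rule_format, of "?n / (2 * m)"] m by auto
      then have "?n \<le> ?n / (2 * m) * m" using t m by force
      then show False using \<open>?n > 0\<close> m by simp
    qed
    have "((\<lambda>s. f s - f t - (s - t) *\<^sub>R D) \<longlongrightarrow> 0) (at t within T)"
    proof (rule tendstoI)
      fix e :: real assume "e > 0"
      \<comment> \<open>Within distance \<open>m\<close> of \<open>t\<close> the factor \<open>\<bar>t + m - s\<bar>\<close> is less than \<open>2 * m\<close>.\<close>
      then obtain d where d: "d > 0" "\<forall>s \<in> {t - d<..<t + d} \<inter> T.
        norm (f (t + m) - f s - (t + m - s) *\<^sub>R D) \<le> e / (2 * m) * \<bar>t + m - s\<bar>"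
        using L[unfolded has_delta_derivative_def, rule_format, of "e / (2 * m)"] m \<open>e > 0\<close>
        by auto
      from near[OF d(1)] near[OF m(1)]
      show "eventually (\<lambda>s. dist (f s - f t - (s - t) *\<^sub>R D) 0 < e) (at t within T)"
      proof eventually_elim
        case (elim s)
        have "f (t + m) - f s - (t + m - s) *\<^sub>R D = - (f s - f t - (s - t) *\<^sub>R D)"
          using J m by (simp add: m_def algebra_simps)
        then have "norm (f s - f t - (s - t) *\<^sub>R D) \<le> e / (2 * m) * \<bar>t + m - s\<bar>"
          using d(2) elim by (metis norm_minus_cancel)
        also have "\<dots> < e / (2 * m) * (2 * m)"
          using elim m \<open>e > 0\<close> by (intro mult_strict_left_mono) auto
        finally show ?case using m by simp
      qed
    qed
    from tendsto_add[OF this lin] have "((\<lambda>s. f s - f t) \<longlongrightarrow> 0) (at t within T)" by simp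
    then have ?C by (simp add: continuous_within LIM_zero_iff)
    with J show "?C \<and> ?J" by simp
  next
    assume R: "?C \<and> ?J"
    show ?L unfolding has_delta_derivative_def
    proof (intro allI impI)
      fix e :: real assume "e > 0"
      have "((\<lambda>s. f s - f t) \<longlongrightarrow> 0) (at t within T)"
        using R by (simp add: continuous_within LIM_zero_iff)
      from tendsto_diff[OF this lin]
      have "((\<lambda>s. f s - f t - (s - t) *\<^sub>R D) \<longlongrightarrow> 0) (at t within T)" by simp
      \<comment> \<open>Within distance \<open>m / 2\<close> of \<open>t\<close> the factor \<open>\<bar>t + m - s\<bar>\<close> is at least \<open>m / 2\<close>.\<close>
      from tendstoD[OF this, of "e * (m / 2)"] obtain d where
        d: "d > 0" "\<And>s. s \<in> T \<Longrightarrow> s \<noteq> t \<Longrightarrow> dist s t < d \<Longrightarrow>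
          norm (f s - f t - (s - t) *\<^sub>R D) < e * (m / 2)"
        using \<open>e > 0\<close> m by (auto simp: eventually_at)
      show "\<exists>d>0. \<forall>s \<in> {t - d<..<t + d} \<inter> T.
          norm (f (fwd_jump T t) - f s - (fwd_jump T t - s) *\<^sub>R D) \<le> e * \<bar>fwd_jump T t - s\<bar>"
      proof (intro exI[of _ "min d (m/2)"] conjI ballI)
        fix s assume s: "s \<in> {t - min d (m/2)<..<t + min d (m/2)} \<inter> T"
        have "norm (f s - f t - (s - t) *\<^sub>R D) \<le> e * (m / 2)"
          using s d \<open>e > 0\<close> m by (cases "s = t") (auto simp: dist_real_def intro!: less_imp_le)
        also have "\<dots> \<le> e * \<bar>t + m - s\<bar>"
          using s \<open>e > 0\<close> by (intro mult_left_mono) auto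
        finally have "norm (f s - f t - (s - t) *\<^sub>R D) \<le> e * \<bar>t + m - s\<bar>" .
        moreover have "f (t + m) - f s - (t + m - s) *\<^sub>R D = - (f s - f t - (s - t) *\<^sub>R D)"
          using R m by (simp add: m_def algebra_simps)
        ultimately show "norm (f (fwd_jump T t) - f s - (fwd_jump T t - s) *\<^sub>R D)
            \<le> e * \<bar>fwd_jump T t - s\<bar>"
          using m by (metis norm_minus_cancel)
      qed (use d m in auto)
    qed
  qed
qed

lemma has_delta_derivative_cases:
  assumes "t \<in> T"
  obtains (fixed) "fwd_jump T t = t" "graininess T t = 0"
      "\<And>(f :: real \<Rightarrow> 'a::real_normed_vector) D.
         has_delta_derivative T f D t \<longleftrightarrow> (f has_vector_derivative D) (at t within T)"
  | (scattered) "graininess T t \<noteq> 0"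
      "\<And>(f :: real \<Rightarrow> 'a::real_normed_vector) D. has_delta_derivative T f D t \<longleftrightarrow>
         continuous (at t within T) f \<and> f (fwd_jump T t) = f t + graininess T t *\<^sub>R D"
proof (cases "fwd_jump T t = t")
  case True
  then show ?thesis
    by (intro that(1)) (simp_all add: graininess_def has_delta_derivative_fixed_iff)
next
  case False
  then have "right_scattered T t"
    using fwd_jump_ge[OF assms] by (simp add: right_scattered_def)
  then show ?thesis using False
    by (intro that(2)) (simp_all add: graininess_def has_delta_derivative_scattered_iff[OF assms])
qed

lemma has_delta_derivative_transform:
  assumes "time_scale T" "t \<in> T" "\<And>s. s \<in> T \<Longrightarrow> f s = g s" "has_delta_derivative T f D t"
  shows "has_delta_derivative T g D t"
  using assms(4) fwd_jump_in[OF assms(1,2)] assms(3)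
  unfolding has_delta_derivative_def by simp

lemma has_delta_derivative_const: "has_delta_derivative T (\<lambda>_. c) 0 t"
  unfolding has_delta_derivative_def by (auto intro: exI[of _ 1])

lemma has_delta_derivative_diff:
  assumes "t \<in> T" "has_delta_derivative T f D t" "has_delta_derivative T g E t"
  shows "has_delta_derivative T (\<lambda>s. f s - g s) (D - E) t"
  using assms(1)
proof (cases t T rule: has_delta_derivative_cases[where 'a = 'a])
  case fixed
  then show ?thesis using assms by (auto intro: has_vector_derivative_diff)
next
  case scattered
  then show ?thesis using assms
    by (auto intro: continuous_diff simp: algebra_simps)
qed

lemma has_delta_derivative_add:
  assumes "t \<in> T" "has_delta_derivative T f D t" "has_delta_derivative T g E t"
  shows "has_delta_derivative T (\<lambda>s. f s + g s) (D + E) t"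
  using assms(1)
proof (cases t T rule: has_delta_derivative_cases[where 'a = 'a])
  case fixed
  then show ?thesis using assms by (auto intro: has_vector_derivative_add)
next
  case scattered
  then show ?thesis using assms
    by (auto intro: continuous_add simp: algebra_simps)
qed

lemma has_delta_derivative_mult:
  fixes f g :: "real \<Rightarrow> 'a::real_normed_algebra"
  assumes "t \<in> T" "has_delta_derivative T f D t" "has_delta_derivative T g E t"
  shows "has_delta_derivative T (\<lambda>s. f s * g s) (f t * E + D * g (fwd_jump T t)) t"
  using assms(1)
proof (cases t T rule: has_delta_derivative_cases[where 'a = 'a])
  case fixed
  then show ?thesis using assms by (auto intro: has_vector_derivative_mult)
next
  case scattered
  then show ?thesis using assms
    by (auto intro: continuous_mult simp: algebra_simps)
qed

lemma has_delta_derivative_mult_left: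
  fixes f :: "real \<Rightarrow> 'a::real_normed_algebra"
  assumes "t \<in> T" "has_delta_derivative T f D t"
  shows "has_delta_derivative T (\<lambda>s. c * f s) (c * D) t"
  using has_delta_derivative_mult[OF assms(1) has_delta_derivative_const[of T c] assms(2)] by simp

lemma has_delta_derivative_divide:
  fixes f g :: "real \<Rightarrow> real"
  assumes "t \<in> T" "has_delta_derivative T f D t" "has_delta_derivative T g E t"
    and nz: "g t \<noteq> 0" "g (fwd_jump T t) \<noteq> 0"
  shows "has_delta_derivative T (\<lambda>s. f s / g s)
    ((D * g t - f t * E) / (g t * g (fwd_jump T t))) t"
  using assms(1)
proof (cases t T rule: has_delta_derivative_cases[where 'a = real])
  case fixed
  then show ?thesis using assms
    by (auto intro: DERIV_divide simp flip: has_real_derivative_iff_has_vector_derivative)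
next
  case scattered
  then have f: "f (fwd_jump T t) = f t + graininess T t * D"
    and g: "g (fwd_jump T t) = g t + graininess T t * E"
    and c: "continuous (at t within T) f" "continuous (at t within T) g"
    using assms by auto
  have "continuous (at t within T) (\<lambda>s. f s / g s)"
    using c nz by (auto intro!: tendsto_divide simp: continuous_within)
  moreover have "f (fwd_jump T t) / g (fwd_jump T t) = f t / g t
      + graininess T t *\<^sub>R ((D * g t - f t * E) / (g t * g (fwd_jump T t)))"
    using f g nz by (simp add: divide_simps) (simp add: algebra_simps)
  ultimately show ?thesis using scattered by simp
qed

text \<open>
  This is why the exponent is built with the cylinder transformation. Across a gap of length \<open>m\<close> the exponent
  grows by \<open>Ln (1 + m z)\<close>, so its exponential is multiplied by \<open>1 + m z\<close>, that is, it has difference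
  quotient \<open>z\<close> times its value. Away from gaps \<open>cylinder 0 z = z\<close> and the chain rule applies.
\<close>

lemma has_delta_derivative_exp:
  fixes F :: "real \<Rightarrow> complex"
  assumes "t \<in> T" "has_delta_derivative T F (cylinder (graininess T t) z) t"
    and nz: "1 + of_real (graininess T t) * z \<noteq> 0"
  shows "has_delta_derivative T (\<lambda>s. exp (F s)) (z * exp (F t)) t"
  using assms(1)
proof (cases t T rule: has_delta_derivative_cases[where 'a = complex])
  case fixed
  then have "(F has_vector_derivative z) (at t within T)"
    using assms by (simp add: cylinder_def)
  then have "(exp \<circ> F has_vector_derivative z * exp (F t)) (at t within T)"
    by (rule field_vector_diff_chain_within) (auto intro: derivative_eq_intros)
  then show ?thesis using fixed by (simp add: o_def)
next
  case scattered
  then have "F (fwd_jump T t) = F t + Ln (1 + of_real (graininess T t) * z)"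
    and c: "continuous (at t within T) F"
    using assms by (simp_all add: cylinder_def scaleR_conv_of_real)
  then have "exp (F (fwd_jump T t)) = exp (F t) + graininess T t *\<^sub>R (z * exp (F t))"
    using nz by (simp add: exp_add scaleR_conv_of_real algebra_simps)
  then show ?thesis using scattered c by (simp add: continuous_within tendsto_exp)
qed

section \<open>Uniqueness of the delta integral\<close>

lemma pre_antiderivativeE:
  assumes "pre_antiderivative T h F"
  obtains D where "continuous_on T F" "D \<subseteq> ts_kappa T" "countable (ts_kappa T - D)"
    "\<And>t. t \<in> ts_kappa T \<Longrightarrow> right_scattered T t \<Longrightarrow> t \<in> D"
    "\<And>t. t \<in> D \<Longrightarrow> has_delta_derivative T F (h t) t"
  using assms unfolding pre_antiderivative_def by blast

lemma pre_antiderivativeI: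
  assumes "continuous_on T F" "D \<subseteq> ts_kappa T" "countable (ts_kappa T - D)"
    "\<And>t. t \<in> ts_kappa T \<Longrightarrow> right_scattered T t \<Longrightarrow> t \<in> D"
    "\<And>t. t \<in> D \<Longrightarrow> has_delta_derivative T F (h t) t"
  shows "pre_antiderivative T h F"
  using assms unfolding pre_antiderivative_def by blast

lemma pre_antiderivative_diff:
  assumes F: "pre_antiderivative T h F" and G: "pre_antiderivative T k G"
  shows "pre_antiderivative T (\<lambda>s. h s - k s) (\<lambda>s. F s - G s)"
proof -
  obtain D where D: "continuous_on T F" "D \<subseteq> ts_kappa T" "countable (ts_kappa T - D)"
      "\<And>t. t \<in> ts_kappa T \<Longrightarrow> right_scattered T t \<Longrightarrow> t \<in> D"
      "\<And>t. t \<in> D \<Longrightarrow> has_delta_derivative T F (h t) t"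
    by (rule pre_antiderivativeE[OF F]) (rule that; assumption)
  obtain E where E: "continuous_on T G" "E \<subseteq> ts_kappa T" "countable (ts_kappa T - E)"
      "\<And>t. t \<in> ts_kappa T \<Longrightarrow> right_scattered T t \<Longrightarrow> t \<in> E"
      "\<And>t. t \<in> E \<Longrightarrow> has_delta_derivative T G (k t) t"
    by (rule pre_antiderivativeE[OF G]) (rule that; assumption)
  show ?thesis
  proof (rule pre_antiderivativeI)
    show "continuous_on T (\<lambda>s. F s - G s)" using D(1) E(1) by (rule continuous_on_diff)
    show "countable (ts_kappa T - D \<inter> E)" using D(3) E(3) by (simp add: Diff_Int)
    show "has_delta_derivative T (\<lambda>s. F s - G s) (h t - k t) t" if "t \<in> D \<inter> E" for t
      using that D(2) by (intro has_delta_derivative_diff D(5) E(5)) (auto dest: ts_kappaD)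
  qed (use D(2,4) E(4) in auto)
qed

lemma pre_antiderivative_mult_left:
  fixes h F :: "real \<Rightarrow> 'a::real_normed_algebra"
  assumes "pre_antiderivative T h F"
  shows "pre_antiderivative T (\<lambda>s. c * h s) (\<lambda>s. c * F s)"
  using assms
proof (rule pre_antiderivativeE)
  fix D assume D: "continuous_on T F" "D \<subseteq> ts_kappa T" "countable (ts_kappa T - D)"
      "\<And>t. t \<in> ts_kappa T \<Longrightarrow> right_scattered T t \<Longrightarrow> t \<in> D"
      "\<And>t. t \<in> D \<Longrightarrow> has_delta_derivative T F (h t) t"
  show ?thesis
  proof (rule pre_antiderivativeI[OF _ D(2-4)])
    show "continuous_on T (\<lambda>s. c * F s)" using D(1) by (rule continuous_on_mult_left)
    show "has_delta_derivative T (\<lambda>s. c * F s) (c * h t) t" if "t \<in> D" for t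
      using that D(2) by (intro has_delta_derivative_mult_left D(5)) (auto dest: ts_kappaD)
  qed
qed

lemma pre_antiderivative_transform:
  assumes "pre_antiderivative T h F" "\<And>s. s \<in> T \<Longrightarrow> h s = k s"
  shows "pre_antiderivative T k F"
  using assms(1)
proof (rule pre_antiderivativeE)
  fix D assume D: "continuous_on T F" "D \<subseteq> ts_kappa T" "countable (ts_kappa T - D)"
      "\<And>t. t \<in> ts_kappa T \<Longrightarrow> right_scattered T t \<Longrightarrow> t \<in> D"
      "\<And>t. t \<in> D \<Longrightarrow> has_delta_derivative T F (h t) t"
  show ?thesis
  proof (rule pre_antiderivativeI[OF D(1-4)])
    fix t assume "t \<in> D"
    then have "t \<in> T" using D(2) by (auto dest: ts_kappaD)
    with D(5)[OF \<open>t \<in> D\<close>] assms(2)[of t] show "has_delta_derivative T F (k t) t" by simp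
  qed
qed

text \<open>
  The mean value inequality with a countable exceptional set. Subtract the allowed growth
  \<open>e (s - a)\<close> from the distance of \<open>F s\<close> to \<open>F a\<close> and suppose that the difference \<open>\<phi>\<close> is positive at \<open>b\<close>.
  Since the image of the exceptional set is countable, some level \<open>y\<close> between \<open>0\<close> and \<open>\<phi> b\<close> is not
  attained on it. Let \<open>x\<close> be the last point with \<open>\<phi> x \<le> y\<close>. If \<open>x\<close> is right-dense, then \<open>\<phi> x = y\<close> by
  continuity, so \<open>x\<close> is not exceptional; a right-scattered point never is. In both cases \<open>F\<close> has
  derivative \<open>0\<close> at \<open>x\<close>, so \<open>\<phi>\<close> drops just after \<open>x\<close>, or across the gap that starts there,
  although \<open>\<phi> > y\<close> to the right of \<open>x\<close>.
\<close>

lemma pre_antiderivative_zero_norm_le: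
  assumes T: "time_scale T" and F: "pre_antiderivative T (\<lambda>_. 0) F"
    and ab: "a \<in> T" "b \<in> T" "a < b" and "e > 0"
  shows "norm (F b - F a) \<le> e * (b - a)"
proof (rule ccontr)
  define \<phi> where "\<phi> s = norm (F s - F a) - e * (s - a)" for s
  assume "\<not> ?thesis"
  then have \<phi>b: "0 < \<phi> b" by (simp add: \<phi>_def)
  have contF: "continuous_on T F" using F by (simp add: pre_antiderivative_def)
  obtain D where D: "D \<subseteq> ts_kappa T" "countable (ts_kappa T - D)"
      "\<And>t. t \<in> ts_kappa T \<Longrightarrow> right_scattered T t \<Longrightarrow> t \<in> D"
      "\<And>t. t \<in> D \<Longrightarrow> has_delta_derivative T F 0 t"
    by (rule pre_antiderivativeE[OF F]) (rule that; assumption)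
  have "countable (\<phi> ` (ts_kappa T - D))" using D(2) by simp
  then have "\<not> {0<..<\<phi> b} \<subseteq> \<phi> ` (ts_kappa T - D)"
    using uncountable_open_interval[of 0 "\<phi> b"] \<phi>b countable_subset by blast
  then obtain y where y: "0 < y" "y < \<phi> b" "y \<notin> \<phi> ` (ts_kappa T - D)"
    unfolding subset_iff greaterThanLessThan_iff by blast
  define A where "A = {s \<in> T \<inter> {a..b}. \<phi> s \<le> y}"
  have "closed (T \<inter> {a..b})" using T by (auto simp: time_scale_def)
  moreover have cont: "continuous_on (T \<inter> {a..b}) \<phi>" unfolding \<phi>_def
    by (intro continuous_intros continuous_on_subset[OF contF]) auto
  ultimately have "closed A" unfolding A_def
    by (intro continuous_on_closed_Collect_le continuous_on_const)
  define x where "x = Sup A"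
  have "a \<in> A" using ab y by (simp add: A_def \<phi>_def)
  have bdd: "bdd_above A" by (auto simp: A_def)
  have "x \<in> A"
    unfolding x_def using \<open>closed A\<close> \<open>a \<in> A\<close> bdd by (intro closed_contains_Sup) auto
  then have x: "x \<in> T" "a \<le> x" "x \<le> b" "\<phi> x \<le> y" by (auto simp: A_def)
  have above: "y < \<phi> s" if "s \<in> T" "x < s" "s \<le> b" for s
    using that x cSup_upper[OF _ bdd, of s] by (force simp: A_def x_def)
  have "x < b" using x y by (cases "x = b") auto
  have \<phi>_diff: "\<phi> s \<le> \<phi> x + norm (F s - F x) - e * (s - x)" for s
    using norm_triangle_ineq[of "F s - F x" "F x - F a"] by (simp add: \<phi>_def algebra_simps)
  from x(1) show False
  proof (cases rule: point_kind)
    case 1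
    have "\<not> is_maximum T x" using \<open>x < b\<close> ab by (force simp: is_maximum_def)
    then have "x \<in> D" using 1 x by (intro D(3)) (simp_all add: ts_kappa_def)
    then have "F (fwd_jump T x) = F x"
      using D(4)[of x] has_delta_derivative_scattered_iff[OF x(1) 1, of F 0] by auto
    moreover have "y < \<phi> (fwd_jump T x)"
      using 1 x \<open>x < b\<close> ab fwd_jump_in[OF T x(1)] fwd_jump_le[OF ab(2), of x]
      by (intro above) (auto simp: right_scattered_def)
    moreover have "e * (fwd_jump T x - x) > 0"
      using 1 \<open>e > 0\<close> by (simp add: right_scattered_def)
    ultimately show False using \<phi>_diff[of "fwd_jump T x"] x by simp
  next
    case 2
    have point: "\<exists>s\<in>T. x < s \<and> s < x + d \<and> s \<le> b" if "d > 0" for d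
      by (rule right_dense_point[OF 2, of "min b (x + d)"]) (use that \<open>x < b\<close> in auto)
    have "\<phi> x = y"
    proof (rule ccontr)
      assume "\<phi> x \<noteq> y"
      then have "y - \<phi> x > 0" using x by simp
      then obtain d where "d > 0"
          "\<And>s. s \<in> T \<inter> {a..b} \<Longrightarrow> dist s x < d \<Longrightarrow> dist (\<phi> s) (\<phi> x) < y - \<phi> x"
        using cont[unfolded continuous_on_iff, rule_format, of x "y - \<phi> x"] x by auto
      moreover obtain s where "s \<in> T" "x < s" "s < x + d" "s \<le> b"
        using point[OF \<open>d > 0\<close>] by auto
      ultimately have "dist (\<phi> s) (\<phi> x) < y - \<phi> x" using x by (auto simp: dist_real_def)
      with above[of s] \<open>s \<in> T\<close> \<open>x < s\<close> \<open>s \<le> b\<close> show False by (simp add: dist_real_def)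
    qed
    have "x \<in> ts_kappa T" using 2 x by (auto simp: ts_kappa_def is_maximum_def right_dense_def not_le)
    then have "x \<in> D" using \<open>\<phi> x = y\<close> y(3) by auto
    moreover have "fwd_jump T x = x" using 2 by (simp add: right_dense_def)
    ultimately obtain d where d: "d > 0"
        "\<forall>s \<in> {x - d<..<x + d} \<inter> T. norm (F x - F s) \<le> e / 2 * \<bar>x - s\<bar>"
      using D(4)[unfolded has_delta_derivative_def, rule_format, of x "e / 2"] \<open>e > 0\<close> by auto
    obtain s where s: "s \<in> T" "x < s" "s < x + d" "s \<le> b"
      using point[OF \<open>d > 0\<close>] by auto
    then have "norm (F s - F x) \<le> e / 2 * (s - x)"
      using d(2)[rule_format, of s] d(1) by (simp add: norm_minus_commute)
    also have "\<dots> < e * (s - x)" using s \<open>e > 0\<close> by simp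
    finally show False using \<phi>_diff[of s] above[of s] s x by simp
  next
    case 3
    then show False using \<open>x < b\<close> ab by (force simp: is_maximum_def)
  qed
qed

lemma pre_antiderivative_zero_const:
  assumes "time_scale T" "pre_antiderivative T (\<lambda>_. 0) F" "a \<in> T" "b \<in> T"
  shows "F a = F b"
proof -
  have *: "F u = F v" if "u \<in> T" "v \<in> T" "u < v" for u v
  proof -
    have "norm (F v - F u) \<le> 0 + e" if "e > 0" for e
      using pre_antiderivative_zero_norm_le[OF assms(1,2) \<open>u \<in> T\<close> \<open>v \<in> T\<close> \<open>u < v\<close>, of "e / (v - u)"]
        that \<open>u < v\<close> by simp
    then have "norm (F v - F u) \<le> 0" by (rule field_le_epsilon)
    then show ?thesis by simp
  qed
  then show ?thesis using assms by (cases a b rule: linorder_cases) (auto simp: *[symmetric])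
qed

text \<open>
  The definite description in \<open>delta_integral\<close> is meaningful because two antiderivatives of the same
  function differ by an antiderivative of \<open>0\<close>, which is constant on \<open>T\<close>.
\<close>

lemma delta_integral_eq:
  assumes "time_scale T" "pre_antiderivative T h F" "a \<in> T" "b \<in> T"
  shows "delta_integral T h a b = F b - F a"
  unfolding delta_integral_def
proof (rule the_equality)
  show "\<exists>G. pre_antiderivative T h G \<and> F b - F a = G b - G a" using assms by blast
next
  fix I assume "\<exists>G. pre_antiderivative T h G \<and> I = G b - G a"
  then obtain G where G: "pre_antiderivative T h G" "I = G b - G a" by blast
  have "pre_antiderivative T (\<lambda>_. 0) (\<lambda>s. F s - G s)"
    using pre_antiderivative_diff[OF assms(2) G(1)] by simp
  from pre_antiderivative_zero_const[OF assms(1) this assms(3,4)]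
  have eq: "F a - G a = F b - G b" .
  have "F b - F a = (F b - G b) - (F a - G a) + (G b - G a)" by simp
  with G(2) eq show "I = F b - F a" by simp
qed

section \<open>Regulated functions are integrable\<close>

text \<open>
  Near each point the function is uniformly close to one that is constant on either side of the point.
  A division that is fine for these neighbourhoods glues the local approximations together, so the
  function is a uniform limit of integrable functions.
\<close>

lemma one_sided_limits_imp_integrable:
  fixes f :: "real \<Rightarrow> 'a::banach"
  assumes lim: "\<And>x. \<exists>l. (f \<longlongrightarrow> l) (at_left x)" "\<And>x. \<exists>l. (f \<longlongrightarrow> l) (at_right x)"
  shows "f integrable_on {a..b}"
proof -
  have "f integrable_on cbox a b"
  proof (rule integrable_uniform_limit)
    fix e :: real assume e: "e > 0"
    have "\<exists>d. d > 0 \<and> (\<exists>l r. (\<forall>y. x - d < y \<and> y < x \<longrightarrow> norm (f y - l) \<le> e) \<and>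
        (\<forall>y. x < y \<and> y < x + d \<longrightarrow> norm (f y - r) \<le> e))" for x
    proof -
      obtain l r where lr: "(f \<longlongrightarrow> l) (at_left x)" "(f \<longlongrightarrow> r) (at_right x)"
        using lim by metis
      have "eventually (\<lambda>y. norm (f y - l) \<le> e) (at_left x)"
          "eventually (\<lambda>y. norm (f y - r) \<le> e) (at_right x)"
        using tendstoD[OF lr(1) e] tendstoD[OF lr(2) e]
        by (auto elim!: eventually_mono simp: dist_norm)
      then obtain c d where cd: "c < x" "x < d" "\<forall>y>c. y < x \<longrightarrow> norm (f y - l) \<le> e"
          "\<forall>y>x. y < d \<longrightarrow> norm (f y - r) \<le> e"
        unfolding eventually_at_left_field eventually_at_right_field by blast
      define m where "m = min (x - c) (d - x)"
      have m: "m > 0" "c \<le> x - m" "x + m \<le> d" using cd by (auto simp: m_def)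
      show ?thesis
      proof (intro exI conjI)
        show "\<forall>y. x - m < y \<and> y < x \<longrightarrow> norm (f y - l) \<le> e" using cd(3) m(2) by simp
        show "\<forall>y. x < y \<and> y < x + m \<longrightarrow> norm (f y - r) \<le> e" using cd(4) m(3) by simp
      qed (fact m)
    qed
    then have "\<exists>d. \<forall>x. d x > 0 \<and> (\<exists>l r. (\<forall>y. x - d x < y \<and> y < x \<longrightarrow> norm (f y - l) \<le> e) \<and>
        (\<forall>y. x < y \<and> y < x + d x \<longrightarrow> norm (f y - r) \<le> e))"
      by (intro choice allI)
    then obtain d where d: "\<And>x. d x > 0" and approx:
        "\<And>x. \<exists>l r. (\<forall>y. x - d x < y \<and> y < x \<longrightarrow> norm (f y - l) \<le> e) \<and>
          (\<forall>y. x < y \<and> y < x + d x \<longrightarrow> norm (f y - r) \<le> e)"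
      by blast
    have "gauge (\<lambda>x. ball x (d x))" using d by (simp add: gauge_def)
    then obtain p where p: "p tagged_division_of cbox a b" "(\<lambda>x. ball x (d x)) fine p"
      using fine_division_exists by blast
    have "\<forall>i\<in>snd ` p. \<exists>g. (\<forall>y\<in>i. norm (f y - g y) \<le> e) \<and> g integrable_on i"
    proof clarsimp
      fix x i assume xi: "(x, i) \<in> p"
      then obtain u v where i: "i = cbox u v" using tagged_division_ofD(4)[OF p(1)] by metis
      have x: "u \<le> x" "x \<le> v" using tagged_division_ofD(2)[OF p(1) xi] i by auto
      have near: "i \<subseteq> ball x (d x)" using xi p(2) by (auto simp: fine_def)
      obtain l r where l: "\<And>y. x - d x < y \<Longrightarrow> y < x \<Longrightarrow> norm (f y - l) \<le> e"
          and r: "\<And>y. x < y \<Longrightarrow> y < x + d x \<Longrightarrow> norm (f y - r) \<le> e"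
        using approx[of x] by blast
      define g where "g y = (if y < x then l else if x < y then r else f x)" for y
      have "g integrable_on {u..x}"
        by (rule integrable_spike_finite[of "{x}" _ _ "\<lambda>_. l"]) (auto simp: g_def)
      moreover have "g integrable_on {x..v}"
        by (rule integrable_spike_finite[of "{x}" _ _ "\<lambda>_. r"]) (auto simp: g_def)
      ultimately have "g integrable_on i"
        using x i Henstock_Kurzweil_Integration.integrable_combine[of u x v g] by simp
      moreover have "norm (f y - g y) \<le> e" if "y \<in> i" for y
      proof -
        have "x - d x < y" "y < x + d x" using near that by (auto simp: dist_real_def)
        then show ?thesis using l r e by (auto simp: g_def)
      qed
      ultimately show "\<exists>g. (\<forall>y\<in>i. norm (f y - g y) \<le> e) \<and> g integrable_on i" by blast
    qed
    then show "\<exists>g. (\<forall>x\<in>cbox a b. norm (f x - g x) \<le> e) \<and> g integrable_on cbox a b"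
      using approximable_on_division[OF less_imp_le[OF e] division_of_tagged_division[OF p(1)]] by metis
  qed
  then show ?thesis by simp
qed

section \<open>Existence of antiderivatives\<close>

text \<open>
  Composing a function with \<open>ts_floor T\<close> extends it from \<open>T\<close> to the real line, constantly
  on each gap with the value at the left end of the gap, so that an ordinary integral of the extension
  over \<open>{t..fwd_jump T t}\<close> is the graininess times the value at \<open>t\<close>. Below \<open>T\<close> the
  infimum makes the extension constant there too, which keeps it integrable on every interval.
\<close>

definition ts_floor :: "real set \<Rightarrow> real \<Rightarrow> real" where
  "ts_floor T x = (if {s \<in> T. s \<le> x} = {} then Inf T else Sup {s \<in> T. s \<le> x})"

lemma ts_floor_in:
  assumes "time_scale T"
  shows "ts_floor T x \<in> T"
proof (cases "{s \<in> T. s \<le> x} = {}")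
  case True
  have "bdd_below T" using True by (intro bdd_belowI[of _ x]) force
  then show ?thesis
    using assms True by (simp add: ts_floor_def time_scale_def closed_contains_Inf)
next
  case False
  have "closed {s \<in> T. s \<le> x}"
    using assms closed_Int[of T "{..x}"] by (simp add: time_scale_def Int_def)
  then have "Sup {s \<in> T. s \<le> x} \<in> {s \<in> T. s \<le> x}"
    using False by (intro closed_contains_Sup bdd_aboveI[of _ x]) auto
  then show ?thesis unfolding ts_floor_def by (subst if_not_P[OF False]) simp
qed

lemma ts_floor_bounds:
  assumes "s \<in> T" "s \<le> x"
  shows "s \<le> ts_floor T x" "ts_floor T x \<le> x"
proof -
  have ne: "{s \<in> T. s \<le> x} \<noteq> {}" using assms by auto
  have eq: "ts_floor T x = Sup {s \<in> T. s \<le> x}"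
    unfolding ts_floor_def by (subst if_not_P[OF ne]) simp
  show "s \<le> ts_floor T x"
    unfolding eq using assms by (intro cSup_upper bdd_aboveI[of _ x]) auto
  show "ts_floor T x \<le> x"
    unfolding eq using ne by (intro cSup_least) auto
qed

lemma ts_floor_ident: "s \<in> T \<Longrightarrow> ts_floor T s = s"
  using ts_floor_bounds[of s T s] by simp

lemma ts_floor_gap:
  assumes "\<And>s. s \<in> T \<Longrightarrow> x < s \<Longrightarrow> y < s" "x \<le> y"
  shows "ts_floor T y = ts_floor T x"
proof -
  have "{s \<in> T. s \<le> y} = {s \<in> T. s \<le> x}"
    using assms by (auto simp: not_less[symmetric])
  then show ?thesis unfolding ts_floor_def by (simp only:)
qed

lemma time_scale_limit_in:
  assumes "time_scale T" "\<And>e. e > 0 \<Longrightarrow> \<exists>s\<in>T. dist s x < e"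
  shows "x \<in> T"
  using assms closed_approachable[of T x] by (auto simp: time_scale_def)

text \<open>
  Either the extension is constant on an interval to the right of \<open>x\<close>, or \<open>x\<close> is a right-dense
  point of \<open>T\<close>, and then \<open>ts_floor T y\<close> lies between \<open>x\<close> and \<open>y\<close>, so that continuity of \<open>h\<close> at \<open>x\<close> applies.
\<close>

lemma rd_continuous_floor_right_limit:
  assumes T: "time_scale T" and h: "rd_continuous T h"
  shows "\<exists>l. ((\<lambda>y. h (ts_floor T y)) \<longlongrightarrow> l) (at_right x)"
proof (cases "\<exists>u>x. \<forall>s\<in>T. x < s \<longrightarrow> u \<le> s")
  case True
  then obtain u where u: "u > x" "\<And>s. s \<in> T \<Longrightarrow> x < s \<Longrightarrow> u \<le> s" by blast
  have "ts_floor T y = ts_floor T x" if "x < y" "y < u" for y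
    using u that by (intro ts_floor_gap) force+
  then have "eventually (\<lambda>y. h (ts_floor T y) = h (ts_floor T x)) (at_right x)"
    unfolding eventually_at_right_field using u(1) by (intro exI[of _ u]) auto
  then show ?thesis by (blast intro: tendsto_eventually)
next
  case False
  then have pt: "\<exists>s\<in>T. x < s \<and> s < u" if "u > x" for u using that by (force simp: not_le)
  have "x \<in> T"
  proof (rule time_scale_limit_in[OF T])
    fix e :: real assume "e > 0"
    then obtain s where "s \<in> T" "x < s" "s < x + e" using pt[of "x + e"] by auto
    then show "\<exists>s\<in>T. dist s x < e" by (intro bexI[of _ s]) (auto simp: dist_real_def)
  qed
  moreover have "fwd_jump T x = x"
  proof (rule ccontr)
    assume "fwd_jump T x \<noteq> x"
    then have "x < fwd_jump T x" using fwd_jump_ge[OF \<open>x \<in> T\<close>] by simp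
    then obtain s where "s \<in> T" "x < s" "s < fwd_jump T x" using pt by blast
    then show False using fwd_jump_le[of s T x] by simp
  qed
  moreover have "\<exists>s\<in>T. x < s" using pt[of "x + 1"] by auto
  ultimately have "continuous (at x within T) h"
    using h by (simp add: rd_continuous_def right_dense_def)
  have "((\<lambda>y. h (ts_floor T y)) \<longlongrightarrow> h x) (at_right x)"
  proof (rule tendstoI)
    fix e :: real assume "e > 0"
    with \<open>continuous (at x within T) h\<close> obtain d where
      d: "d > 0" "\<And>s. s \<in> T \<Longrightarrow> dist s x < d \<Longrightarrow> dist (h s) (h x) < e"
      unfolding continuous_within_eps_delta by (auto simp: dist_commute)
    have "dist (h (ts_floor T y)) (h x) < e" if "x < y" "y < x + d" for y
      using ts_floor_bounds[OF \<open>x \<in> T\<close>, of y] that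
      by (intro d(2) ts_floor_in[OF T]) (auto simp: dist_real_def)
    then show "eventually (\<lambda>y. dist (h (ts_floor T y)) (h x) < e) (at_right x)"
      unfolding eventually_at_right_field using d(1) by (intro exI[of _ "x + d"]) auto
  qed
  then show ?thesis by blast
qed

text \<open>
  As on the right, with left-dense points in place of right-dense ones. A point \<open>s\<close> of \<open>T\<close> close
  to \<open>x\<close> has to be chosen first, as \<open>ts_floor T y\<close> is bounded below only by points of \<open>T\<close> below \<open>y\<close>.
\<close>

lemma rd_continuous_floor_left_limit:
  assumes T: "time_scale T" and h: "rd_continuous T h"
  shows "\<exists>l. ((\<lambda>y. h (ts_floor T y)) \<longlongrightarrow> l) (at_left x)"
proof (cases "\<exists>u<x. \<forall>s\<in>T. s < x \<longrightarrow> s \<le> u")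
  case True
  then obtain u where u: "u < x" "\<And>s. s \<in> T \<Longrightarrow> s < x \<Longrightarrow> s \<le> u" by blast
  have "ts_floor T y = ts_floor T u" if "u < y" "y < x" for y
    using u that by (intro ts_floor_gap) force+
  then have "eventually (\<lambda>y. h (ts_floor T y) = h (ts_floor T u)) (at_left x)"
    unfolding eventually_at_left_field using u(1) by (intro exI[of _ u]) auto
  then show ?thesis by (blast intro: tendsto_eventually)
next
  case False
  then have pt: "\<exists>s\<in>T. u < s \<and> s < x" if "u < x" for u using that by (force simp: not_le)
  have "x \<in> T"
  proof (rule time_scale_limit_in[OF T])
    fix e :: real assume "e > 0"
    then obtain s where "s \<in> T" "x - e < s" "s < x" using pt[of "x - e"] by auto
    then show "\<exists>s\<in>T. dist s x < e" by (intro bexI[of _ s]) (auto simp: dist_real_def)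
  qed
  have ne: "{s \<in> T. s < x} \<noteq> {}" using pt[of "x - 1"] by auto
  have "Sup {s \<in> T. s < x} = x"
  proof (rule cSup_eq_non_empty[OF ne])
    fix u assume "\<And>s. s \<in> {s \<in> T. s < x} \<Longrightarrow> s \<le> u"
    then show "x \<le> u" using pt[of u] by (force simp: not_le[symmetric])
  qed auto
  then have "bwd_jump T x = x" unfolding bwd_jump_def by (subst if_not_P[OF ne])
  then obtain l where "(h \<longlongrightarrow> l) (at x within T \<inter> {..<x})"
    using h \<open>x \<in> T\<close> ne by (auto simp: rd_continuous_def left_dense_def)
  have "((\<lambda>y. h (ts_floor T y)) \<longlongrightarrow> l) (at_left x)"
  proof (rule tendstoI)
    fix e :: real assume "e > 0"
    from tendstoD[OF \<open>(h \<longlongrightarrow> l) _\<close> this] obtain d where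
      d: "d > 0" "\<And>s. s \<in> T \<Longrightarrow> s < x \<Longrightarrow> dist s x < d \<Longrightarrow> dist (h s) l < e"
      unfolding eventually_at by auto
    obtain s where s: "s \<in> T" "x - d < s" "s < x" using pt[of "x - d"] d(1) by auto
    have "dist (h (ts_floor T y)) l < e" if "s < y" "y < x" for y
      using ts_floor_bounds[OF s(1), of y] that s
      by (intro d(2) ts_floor_in[OF T]) (auto simp: dist_real_def)
    then show "eventually (\<lambda>y. dist (h (ts_floor T y)) l < e) (at_left x)"
      unfolding eventually_at_left_field using s(3) by (intro exI[of _ s]) auto
  qed
  then show ?thesis by blast
qed

lemma indefinite_integral_exists:
  fixes f :: "real \<Rightarrow> 'a::banach"
  assumes int: "\<And>a b. f integrable_on {a..b}"
  obtains F where "continuous_on UNIV F" "\<And>a b. a \<le> b \<Longrightarrow> (f has_integral F b - F a) {a..b}"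
proof -
  define F where "F x = (if 0 \<le> x then integral {0..x} f else - integral {x..0} f)" for x
  have F: "integral {a..b} f = F b - F a" if "a \<le> b" for a b
  proof -
    consider "0 \<le> a" | "a < 0" "0 \<le> b" | "b < 0" by linarith
    then show ?thesis
      using that Henstock_Kurzweil_Integration.integral_combine[OF _ _ int, of 0 a b]
        Henstock_Kurzweil_Integration.integral_combine[OF _ _ int, of a 0 b]
        Henstock_Kurzweil_Integration.integral_combine[OF _ _ int, of a b 0]
      by cases (auto simp: F_def algebra_simps)
  qed
  have "continuous (at x) F" for x
  proof -
    have "continuous_on {x - 1..x + 1} (\<lambda>y. F (x - 1) + integral {x - 1..y} f)"
      by (intro continuous_intros indefinite_integral_continuous_1 int)
    then have "continuous_on {x - 1..x + 1} F"
      by (rule continuous_on_eq) (simp add: F)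
    then show ?thesis by (rule continuous_on_interior) simp
  qed
  then have "continuous_on UNIV F" by (simp add: continuous_on_eq_continuous_at)
  moreover have "(f has_integral F b - F a) {a..b}" if "a \<le> b" for a b
    using integrable_integral[OF int[of a b]] F[OF that] by simp
  ultimately show ?thesis by (rule that)
qed

lemma integral_near_constant:
  fixes f :: "real \<Rightarrow> 'a::banach"
  assumes "(f has_integral i) {a..b}" "a \<le> b" "0 \<le> e" "\<And>x. x \<in> {a..b} \<Longrightarrow> norm (f x - c) \<le> e"
  shows "norm (i - (b - a) *\<^sub>R c) \<le> e * (b - a)"
proof -
  have "((\<lambda>x. f x - c) has_integral i - (b - a) *\<^sub>R c) {a..b}"
    using has_integral_diff[OF assms(1) has_integral_const_real[of c a b]] \<open>a \<le> b\<close> by simp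
  from has_integral_bound_real[OF assms(3) finite.emptyI this] assms(2,4) show ?thesis by simp
qed

text \<open>
  The antiderivative is an indefinite integral of the extension of \<open>h\<close> along \<open>ts_floor T\<close>.
  Where \<open>t\<close> is not right-scattered and \<open>h\<close> is continuous at \<open>t\<close>, the extension
  is close to \<open>h t\<close> on the interval between \<open>t\<close> and any nearby point of \<open>T\<close>; across a gap it equals \<open>h t\<close>.
  Only a maximum can be neither right-scattered nor right-dense, so the exceptional set has at most one point;
  at a maximum the derivative exists if \<open>h\<close> is continuous there.
\<close>

lemma rd_continuous_antiderivative:
  fixes h :: "real \<Rightarrow> 'a::banach"
  assumes T: "time_scale T" and h: "rd_continuous T h"
  obtains F where "pre_antiderivative T h F"
    "\<forall>t\<in>T. (is_maximum T t \<longrightarrow> continuous (at t within T) h) \<longrightarrow>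
      has_delta_derivative T F (h t) t"
proof -
  define H where "H y = h (ts_floor T y)" for y
  have "H integrable_on {a..b}" for a b
    unfolding H_def using rd_continuous_floor_left_limit[OF T h] rd_continuous_floor_right_limit[OF T h]
    by (rule one_sided_limits_imp_integrable)
  then obtain F where contF: "continuous_on UNIV F"
    and F: "\<And>a b. a \<le> b \<Longrightarrow> (H has_integral F b - F a) {a..b}"
    by (rule indefinite_integral_exists) (rule that; assumption)
  have dense: "has_delta_derivative T F (h t) t"
    if t: "t \<in> T" "fwd_jump T t = t" "continuous (at t within T) h" for t
    unfolding has_delta_derivative_fixed_iff[OF t(2)] has_vector_derivative_def has_derivative_within_alt
  proof (intro conjI allI impI bounded_linear_scaleR_left)
    fix e :: real assume "e > 0"
    with t(3) obtain d where d: "d > 0" "\<And>s. s \<in> T \<Longrightarrow> dist s t < d \<Longrightarrow> dist (h s) (h t) < e"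
      unfolding continuous_within_eps_delta by (auto simp: dist_commute)
    \<comment> \<open>The interval must start at a point \<open>u\<close> of \<open>T\<close>, which keeps \<open>ts_floor T y\<close> near \<open>t\<close>;
      nothing of the kind holds to the left of a left-scattered \<open>t\<close>.\<close>
    have H: "norm (H y - h t) \<le> e" if "u \<in> T" "u \<le> y" "t - d < u" "y < t + d" for u y
      using d(2)[OF ts_floor_in[OF T, of y]] ts_floor_bounds[OF that(1,2)] that(3,4)
      by (force simp: H_def dist_norm)
    show "\<exists>d>0. \<forall>s\<in>T. norm (s - t) < d \<longrightarrow>
        norm (F s - F t - (s - t) *\<^sub>R h t) \<le> e * norm (s - t)"
    proof (intro exI conjI ballI impI)
      fix s assume s: "s \<in> T" "norm (s - t) < d"
      show "norm (F s - F t - (s - t) *\<^sub>R h t) \<le> e * norm (s - t)"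
      proof (cases "t \<le> s")
        case True
        have "norm (F s - F t - (s - t) *\<^sub>R h t) \<le> e * (s - t)"
          using True s \<open>e > 0\<close> d(1)
          by (intro integral_near_constant[OF F] H[of t]) (auto simp: t(1))
        then show ?thesis using True by simp
      next
        case False
        have "norm (F t - F s - (t - s) *\<^sub>R h t) \<le> e * (t - s)"
          using False s \<open>e > 0\<close> d(1)
          by (intro integral_near_constant[OF F] H[of s]) auto
        moreover have "F s - F t - (s - t) *\<^sub>R h t = - (F t - F s - (t - s) *\<^sub>R h t)"
          by (simp add: algebra_simps)
        ultimately show ?thesis using False by (simp only: norm_minus_cancel) simp
      qed
    qed (fact d(1))
  qed
  have scattered: "has_delta_derivative T F (h t) t" if t: "t \<in> T" "right_scattered T t" for t
    unfolding has_delta_derivative_scattered_iff[OF t]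
  proof
    show "continuous (at t within T) F"
      using contF by (simp add: continuous_on_eq_continuous_at continuous_at_imp_continuous_at_within)
    have lt: "t < fwd_jump T t" using t(2) by (simp add: right_scattered_def)
    have "H y = h t" if "y \<in> {t..fwd_jump T t} - {fwd_jump T t}" for y
    proof -
      have "y < s" if "s \<in> T" "t < s" for s
        using fwd_jump_le[OF that] \<open>y \<in> _\<close> by auto
      then have "ts_floor T y = ts_floor T t"
        using \<open>y \<in> _\<close> by (intro ts_floor_gap) auto
      then show ?thesis by (simp add: H_def ts_floor_ident[OF t(1)])
    qed
    then have "(H has_integral Henstock_Kurzweil_Integration.content {t..fwd_jump T t} *\<^sub>R h t) {t..fwd_jump T t}"
      by (intro has_integral_spike_finite[OF _ _ has_integral_const_real,
            where S = "{fwd_jump T t}"]) auto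
    then have "(H has_integral graininess T t *\<^sub>R h t) {t..fwd_jump T t}"
      using lt by (simp add: graininess_def)
    from has_integral_unique[OF F this] lt
    have "F (fwd_jump T t) - F t = graininess T t *\<^sub>R h t" by simp
    then show "F (fwd_jump T t) = F t + graininess T t *\<^sub>R h t" by (simp add: diff_eq_eq add.commute)
  qed
  have deriv: "has_delta_derivative T F (h t) t"
    if "t \<in> T" "is_maximum T t \<Longrightarrow> continuous (at t within T) h" for t
    using \<open>t \<in> T\<close>
  proof (cases rule: point_kind)
    case 1
    then show ?thesis using that by (intro scattered)
  next
    case 2
    then show ?thesis using that h by (intro dense) (auto simp: right_dense_def rd_continuous_def)
  next
    case 3
    then show ?thesis using that by (intro dense fwd_jump_maximum)
  qed
  have "pre_antiderivative T h F"
  proof (rule pre_antiderivativeI)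
    show "continuous_on T F" using contF by (rule continuous_on_subset) simp
    have "ts_kappa T - {t \<in> ts_kappa T. \<not> is_maximum T t} \<subseteq> {Sup T}"
      by (auto simp: is_maximum_def intro!: cSup_eq_maximum[symmetric])
    then show "countable (ts_kappa T - {t \<in> ts_kappa T. \<not> is_maximum T t})"
      by (rule countable_subset) simp
    show "t \<in> {t \<in> ts_kappa T. \<not> is_maximum T t}" if "t \<in> ts_kappa T" "right_scattered T t" for t
      using that fwd_jump_maximum[of T t] by (auto simp: right_scattered_def)
    show "has_delta_derivative T F (h t) t" if "t \<in> {t \<in> ts_kappa T. \<not> is_maximum T t}" for t
      using that by (intro deriv) (auto dest: ts_kappaD)
  qed auto
  then show ?thesis using deriv by (intro that) blast+
qed

section \<open>Rd-continuity\<close>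

lemma rd_continuous_of_real:
  assumes "rd_continuous T q"
  shows "rd_continuous T (\<lambda>s. complex_of_real (q s))"
  unfolding rd_continuous_def
proof (intro conjI ballI impI)
  fix t assume "t \<in> T"
  show "continuous (at t within T) (\<lambda>s. complex_of_real (q s))" if "right_dense T t"
    using assms that \<open>t \<in> T\<close> by (intro continuous_of_real) (simp add: rd_continuous_def)
  assume "left_dense T t"
  then obtain l where "(q \<longlongrightarrow> l) (at t within T \<inter> {..<t})"
    using assms \<open>t \<in> T\<close> by (auto simp: rd_continuous_def)
  from tendsto_of_real[OF this]
  show "\<exists>l. ((\<lambda>s. complex_of_real (q s)) \<longlongrightarrow> l) (at t within T \<inter> {..<t})" by blast
qed

lemma rd_continuous_mult:
  fixes h F :: "real \<Rightarrow> 'a::real_normed_algebra"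
  assumes h: "rd_continuous T h" and F: "continuous_on T F"
  shows "rd_continuous T (\<lambda>s. h s * F s)"
  unfolding rd_continuous_def
proof (intro conjI ballI impI)
  fix t assume "t \<in> T"
  then have Ft: "continuous (at t within T) F" using F by (simp add: continuous_on_eq_continuous_within)
  show "continuous (at t within T) (\<lambda>s. h s * F s)" if "right_dense T t"
    using h that \<open>t \<in> T\<close> Ft by (intro continuous_mult) (auto simp: rd_continuous_def)
  assume "left_dense T t"
  then obtain l where l: "(h \<longlongrightarrow> l) (at t within T \<inter> {..<t})"
    using h \<open>t \<in> T\<close> by (auto simp: rd_continuous_def)
  have "(F \<longlongrightarrow> F t) (at t within T \<inter> {..<t})"
    using Ft unfolding continuous_within by (rule tendsto_within_subset) auto
  from tendsto_mult[OF l this]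
  show "\<exists>l. ((\<lambda>s. h s * F s) \<longlongrightarrow> l) (at t within T \<inter> {..<t})" by blast
qed

text \<open>
  Write the cylinder transformation as \<open>cylinder m q = q * \<phi> (m q)\<close> with \<open>\<phi> w = Ln (1 + w) / w\<close>, which extends
  continuously by \<open>1\<close> to \<open>w = 0\<close> because \<open>Ln\<close> has derivative \<open>1\<close> at \<open>1\<close>.
\<close>

lemma tendsto_cylinder:
  assumes "(m \<longlongrightarrow> 0) G" "(q \<longlongrightarrow> l) G"
  shows "((\<lambda>s. cylinder (m s) (q s)) \<longlongrightarrow> l) G"
proof -
  define \<phi> :: "complex \<Rightarrow> complex" where "\<phi> w = (if w = 0 then 1 else Ln (1 + w) / w)" for w
  have "(Ln has_field_derivative inverse 1) (at 1)"
    by (rule has_field_derivative_Ln) (simp add: complex_nonpos_Reals_iff)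
  then have "((\<lambda>w::complex. Ln (1 + w) / w) \<longlongrightarrow> 1) (at 0)" by (simp add: DERIV_def)
  then have "(\<phi> \<longlongrightarrow> 1) (at 0)"
    by (rule Lim_transform_eventually) (auto simp: \<phi>_def eventually_at intro: exI[of _ 1])
  then have "isCont \<phi> 0" by (simp add: isCont_def \<phi>_def)
  moreover have "((\<lambda>s. of_real (m s) * q s) \<longlongrightarrow> 0) G"
    using tendsto_mult[OF tendsto_of_real[OF assms(1)] assms(2)] by simp
  ultimately have "((\<lambda>s. \<phi> (of_real (m s) * q s)) \<longlongrightarrow> \<phi> 0) G"
    by (rule isCont_tendsto_compose)
  from tendsto_mult[OF assms(2) this]
  have "((\<lambda>s. q s * \<phi> (of_real (m s) * q s)) \<longlongrightarrow> l) G" by (simp add: \<phi>_def)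
  moreover have "q s * \<phi> (of_real (m s) * q s) = cylinder (m s) (q s)" for s
    by (auto simp: \<phi>_def cylinder_def)
  ultimately show ?thesis by simp
qed

lemma continuous_cylinder:
  assumes "(graininess T \<longlongrightarrow> 0) (at t within T)" "fwd_jump T t = t" "continuous (at t within T) q"
  shows "continuous (at t within T) (\<lambda>s. cylinder (graininess T s) (q s))"
  using tendsto_cylinder[OF assms(1) assms(3)[unfolded continuous_within]] assms(2)
  by (simp add: continuous_within graininess_def cylinder_def)

lemma continuous_cylinder_maximum:
  assumes "is_maximum T t" "continuous (at t within T) q"
  shows "continuous (at t within T) (\<lambda>s. cylinder (graininess T s) (q s))"
  using assms
  by (intro continuous_cylinder graininess_tendsto_from_left fwd_jump_maximum)
    (auto simp: is_maximum_def)

text \<open>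
  At the points where rd-continuity makes a demand the graininess tends to \<open>0\<close>, so the limits of the
  transformed function are those of \<open>q\<close>.
\<close>

lemma rd_continuous_cylinder:
  assumes q: "rd_continuous T q"
  shows "rd_continuous T (\<lambda>s. cylinder (graininess T s) (q s))"
  unfolding rd_continuous_def
proof (intro conjI ballI impI)
  fix t assume "t \<in> T"
  show "continuous (at t within T) (\<lambda>s. cylinder (graininess T s) (q s))" if "right_dense T t"
    using q that \<open>t \<in> T\<close>
    by (intro continuous_cylinder graininess_tendsto_right_dense)
      (auto simp: rd_continuous_def right_dense_def)
  assume "left_dense T t"
  then obtain l where l: "(q \<longlongrightarrow> l) (at t within T \<inter> {..<t})"
    using q \<open>t \<in> T\<close> by (auto simp: rd_continuous_def)
  have "(graininess T \<longlongrightarrow> 0) (at t within T \<inter> {..<t})"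
    using \<open>t \<in> T\<close> by (intro graininess_tendsto_from_left) auto
  from tendsto_cylinder[OF this l]
  show "\<exists>l. ((\<lambda>s. cylinder (graininess T s) (q s)) \<longlongrightarrow> l) (at t within T \<inter> {..<t})" by blast
qed

section \<open>The exponential\<close>

text \<open>
  Separating the two variables of the exponential makes it accessible to the product rule: the first
  factor carries all dependence on \<open>r\<close>, and the second one can be taken out of a derivative, or kept
  under an integral over \<open>s\<close> when the first one is taken out.
\<close>

lemma ts_exp_factorization:
  assumes T: "time_scale T" and q: "rd_continuous T q"
  obtains F where "continuous_on T F"
    "\<forall>r\<in>T. \<forall>s\<in>T. ts_exp T q r s = exp (F r) * exp (- F s)"
    "\<forall>t\<in>T. (is_maximum T t \<longrightarrow> continuous (at t within T) q) \<longrightarrow>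
      1 + graininess T t * q t \<noteq> 0 \<longrightarrow>
      has_delta_derivative T (\<lambda>r. exp (F r)) (of_real (q t) * exp (F t)) t"
proof -
  define h where "h = (\<lambda>s. cylinder (graininess T s) (complex_of_real (q s)))"
  have "rd_continuous T h"
    unfolding h_def by (intro rd_continuous_cylinder rd_continuous_of_real q)
  then obtain F where F: "pre_antiderivative T h F"
    "\<forall>t\<in>T. (is_maximum T t \<longrightarrow> continuous (at t within T) h) \<longrightarrow>
      has_delta_derivative T F (h t) t"
    by (rule rd_continuous_antiderivative[OF T])
  show ?thesis
  proof
    show "continuous_on T F" using F(1) by (simp add: pre_antiderivative_def)
    show "\<forall>r\<in>T. \<forall>s\<in>T. ts_exp T q r s = exp (F r) * exp (- F s)"
      using delta_integral_eq[OF T F(1)]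
      by (simp add: ts_exp_def exp_diff exp_minus divide_inverse flip: h_def)
  next
    show "\<forall>t\<in>T. (is_maximum T t \<longrightarrow> continuous (at t within T) q) \<longrightarrow>
      1 + graininess T t * q t \<noteq> 0 \<longrightarrow>
      has_delta_derivative T (\<lambda>r. exp (F r)) (of_real (q t) * exp (F t)) t"
    proof (intro ballI impI)
      fix t assume t: "t \<in> T" "is_maximum T t \<longrightarrow> continuous (at t within T) q"
        "1 + graininess T t * q t \<noteq> 0"
      have "has_delta_derivative T F (h t) t"
        using t by (intro F(2)[rule_format])
          (auto simp: h_def intro!: continuous_cylinder_maximum continuous_of_real)
      moreover have "1 + of_real (graininess T t) * complex_of_real (q t) \<noteq> 0"
        using t(3) by (metis of_real_1 of_real_add of_real_eq_0_iff of_real_mult)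
      ultimately show "has_delta_derivative T (\<lambda>r. exp (F r)) (of_real (q t) * exp (F t)) t"
        using t(1) by (intro has_delta_derivative_exp) (simp_all add: h_def)
    qed
  qed
qed

section \<open>The conformable derivative\<close>

lemma has_conf_derivativeI:
  assumes "has_delta_derivative T f d t" "D = k1 \<alpha> t *\<^sub>R f t + k0 \<alpha> t *\<^sub>R d"
  shows "has_conf_derivative T k0 k1 \<alpha> f D t"
  using assms unfolding has_conf_derivative_def by blast

theorem theorem3p10:
  fixes T :: "real set" and \<alpha> :: real and k0 k1 :: "real \<Rightarrow> real \<Rightarrow> real"
    and p f g :: "real \<Rightarrow> real" and t :: real
  assumes "time_scale T"
    and "\<alpha> \<in> {0..1}"
    and "admissible_pair T k0 k1"
    and "rd_continuous T p"
    and "0 < \<alpha> \<Longrightarrow> \<forall>r\<in>ts_kappa T. 1 + graininess T r * conf_quotient k0 k1 \<alpha> p r \<noteq> 0"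
    and "t \<in> ts_kappa T"
  shows
    "(\<forall>F G a b. has_conf_derivative T k0 k1 \<alpha> f F t \<and> has_conf_derivative T k0 k1 \<alpha> g G t \<longrightarrow>
        has_conf_derivative T k0 k1 \<alpha> (\<lambda>r. a * f r + b * g r) (a * F + b * G) t)
   \<and> (\<forall>c::real. has_conf_derivative T k0 k1 \<alpha> (\<lambda>r. c) (c * k1 \<alpha> t) t)
   \<and> (\<forall>F G. has_conf_derivative T k0 k1 \<alpha> f F t \<and> has_conf_derivative T k0 k1 \<alpha> g G t \<longrightarrow>
        has_conf_derivative T k0 k1 \<alpha> (\<lambda>r. f r * g r)
          (f t * G + g (fwd_jump T t) * F - f t * g (fwd_jump T t) * k1 \<alpha> t) t)
   \<and> (\<forall>F G. has_conf_derivative T k0 k1 \<alpha> f F t \<and> has_conf_derivative T k0 k1 \<alpha> g G t \<and>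
        g t * g (fwd_jump T t) \<noteq> 0 \<longrightarrow>
        has_conf_derivative T k0 k1 \<alpha> (\<lambda>r. f r / g r)
          ((g t * F - f t * G) / (g t * g (fwd_jump T t)) + f t / g t * k1 \<alpha> t) t)
   \<and> (\<forall>s\<in>T. 0 < \<alpha> \<and> s \<le> t \<and>
        rd_continuous T (conf_quotient k0 k1 \<alpha> p) \<and>
        (is_maximum T t \<longrightarrow> continuous (at t within T) (conf_quotient k0 k1 \<alpha> p)) \<longrightarrow>
        has_conf_derivative T k0 k1 \<alpha> (\<lambda>r. conf_exp T k0 k1 \<alpha> p r s)
          (complex_of_real (p t) * conf_exp T k0 k1 \<alpha> p t s) t)
   \<and> (\<forall>a\<in>T. 0 < \<alpha> \<and> a \<le> t \<and>
        (\<forall>r\<in>ts_kappa T. 1 + graininess T r * conf_quotient k0 k1 \<alpha> (\<lambda>_. 0) r \<noteq> 0) \<and>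
        rd_continuous T (conf_quotient k0 k1 \<alpha> (\<lambda>_. 0)) \<and>
        rd_continuous T (\<lambda>s. f s / k0 \<alpha> s) \<and>
        (is_maximum T t \<longrightarrow> continuous (at t within T) (conf_quotient k0 k1 \<alpha> (\<lambda>_. 0)) \<and>
           continuous (at t within T) (\<lambda>s. f s / k0 \<alpha> s)) \<longrightarrow>
        has_conf_derivative T k0 k1 \<alpha>
          (\<lambda>r. delta_integral T
             (\<lambda>s. complex_of_real (f s) * conf_exp T k0 k1 \<alpha> (\<lambda>_. 0) r s
                   / complex_of_real (k0 \<alpha> s)) a r)
          (complex_of_real (f t) * conf_exp T k0 k1 \<alpha> (\<lambda>_. 0) (fwd_jump T t) t) t)"
proof (intro conjI allI ballI impI; (elim conjE)?)
  have T: "time_scale T" and t: "t \<in> T" using assms(1,6) by (auto dest: ts_kappaD)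
  note has_conf = has_conf_derivative_def
  have k0: "k0 \<alpha> t \<noteq> 0" if "0 < \<alpha>"
    using assms(2,3) t that by (simp add: admissible_pair_def)
  {
    fix F G a b
    assume "has_conf_derivative T k0 k1 \<alpha> f F t" "has_conf_derivative T k0 k1 \<alpha> g G t"
    then obtain d e where "has_delta_derivative T f d t" "F = k1 \<alpha> t * f t + k0 \<alpha> t * d"
      "has_delta_derivative T g e t" "G = k1 \<alpha> t * g t + k0 \<alpha> t * e"
      by (auto simp: has_conf)
    then show "has_conf_derivative T k0 k1 \<alpha> (\<lambda>r. a * f r + b * g r) (a * F + b * G) t"
      using t
      by (intro has_conf_derivativeI[of T _ "a * d + b * e"] has_delta_derivative_add
          has_delta_derivative_mult_left) (auto simp: algebra_simps)
  next
    fix c :: real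
    show "has_conf_derivative T k0 k1 \<alpha> (\<lambda>r. c) (c * k1 \<alpha> t) t"
      by (rule has_conf_derivativeI[OF has_delta_derivative_const]) simp
  next
    fix F G
    assume "has_conf_derivative T k0 k1 \<alpha> f F t" "has_conf_derivative T k0 k1 \<alpha> g G t"
    then obtain d e where d: "has_delta_derivative T f d t" "F = k1 \<alpha> t * f t + k0 \<alpha> t * d"
      and e: "has_delta_derivative T g e t" "G = k1 \<alpha> t * g t + k0 \<alpha> t * e"
      by (auto simp: has_conf)
    show "has_conf_derivative T k0 k1 \<alpha> (\<lambda>r. f r * g r)
          (f t * G + g (fwd_jump T t) * F - f t * g (fwd_jump T t) * k1 \<alpha> t) t"
      by (rule has_conf_derivativeI[OF has_delta_derivative_mult[OF t d(1) e(1)]])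
        (simp add: d(2) e(2) algebra_simps)
    assume nz: "g t * g (fwd_jump T t) \<noteq> 0"
    then have nz: "g t \<noteq> 0" "g (fwd_jump T t) \<noteq> 0" by auto
    show "has_conf_derivative T k0 k1 \<alpha> (\<lambda>r. f r / g r)
          ((g t * F - f t * G) / (g t * g (fwd_jump T t)) + f t / g t * k1 \<alpha> t) t"
      by (rule has_conf_derivativeI[OF has_delta_derivative_divide[OF t d(1) e(1) nz]])
        (use nz in \<open>simp add: d(2) e(2) divide_simps\<close>, simp add: algebra_simps)
  next
    fix s assume s: "s \<in> T" "0 < \<alpha>" "rd_continuous T (conf_quotient k0 k1 \<alpha> p)"
      "is_maximum T t \<longrightarrow> continuous (at t within T) (conf_quotient k0 k1 \<alpha> p)"
    define q where "q = conf_quotient k0 k1 \<alpha> p"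
    have "rd_continuous T q" using s(3) by (simp add: q_def)
    then obtain F where "continuous_on T F"
      and F: "\<forall>r\<in>T. \<forall>s\<in>T. ts_exp T q r s = exp (F r) * exp (- F s)"
      and dF: "\<forall>t\<in>T. (is_maximum T t \<longrightarrow> continuous (at t within T) q) \<longrightarrow>
        1 + graininess T t * q t \<noteq> 0 \<longrightarrow>
        has_delta_derivative T (\<lambda>r. exp (F r)) (of_real (q t) * exp (F t)) t"
      by (rule ts_exp_factorization[OF T])
    have "has_delta_derivative T (\<lambda>r. exp (F r)) (of_real (q t) * exp (F t)) t"
      using s(2,4) assms(5,6) by (intro dF[rule_format] t) (simp_all add: q_def)
    from has_delta_derivative_mult_left[OF t this]
    have "has_delta_derivative T (\<lambda>r. exp (- F s) * exp (F r))
        (exp (- F s) * (of_real (q t) * exp (F t))) t" .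
    then have dE: "has_delta_derivative T (\<lambda>r. conf_exp T k0 k1 \<alpha> p r s)
        (exp (- F s) * (of_real (q t) * exp (F t))) t"
      by (rule has_delta_derivative_transform[OF T t, rotated])
        (simp add: F s(1) conf_exp_def mult.commute flip: q_def)
    \<comment> \<open>By the choice of \<open>q\<close>, the delta equation with coefficient \<open>q\<close> is the conformable one with \<open>p\<close>.\<close>
    have eq: "of_real (p t) = of_real (k1 \<alpha> t) + of_real (k0 \<alpha> t) * complex_of_real (q t)"
      using k0[OF s(2)] by (simp add: q_def conf_quotient_def flip: of_real_mult of_real_add)
    have "complex_of_real (p t) * (exp (F t) * exp (- F s)) =
        of_real (k1 \<alpha> t) * (exp (F t) * exp (- F s)) +
        of_real (k0 \<alpha> t) * (exp (- F s) * (of_real (q t) * exp (F t)))"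
      unfolding eq by (simp add: algebra_simps)
    then show "has_conf_derivative T k0 k1 \<alpha> (\<lambda>r. conf_exp T k0 k1 \<alpha> p r s)
          (complex_of_real (p t) * conf_exp T k0 k1 \<alpha> p t s) t"
      by (intro has_conf_derivativeI[OF dE])
        (simp add: conf_exp_def F t s(1) scaleR_conv_of_real flip: q_def)
  next
    fix a
    let ?q = "conf_quotient k0 k1 \<alpha> (\<lambda>_. 0)"
    assume a: "a \<in> T" "0 < \<alpha>"
      and reg: "\<forall>r\<in>ts_kappa T. 1 + graininess T r * ?q r \<noteq> 0"
      and q: "rd_continuous T ?q" and fk: "rd_continuous T (\<lambda>s. f s / k0 \<alpha> s)"
      and max: "is_maximum T t \<longrightarrow> continuous (at t within T) ?q \<and>
        continuous (at t within T) (\<lambda>s. f s / k0 \<alpha> s)"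
    obtain F where contF: "continuous_on T F"
      and F: "\<forall>r\<in>T. \<forall>s\<in>T. conf_exp T k0 k1 \<alpha> (\<lambda>_. 0) r s = exp (F r) * exp (- F s)"
      and dF: "\<forall>t\<in>T. (is_maximum T t \<longrightarrow> continuous (at t within T) ?q) \<longrightarrow>
        1 + graininess T t * ?q t \<noteq> 0 \<longrightarrow>
        has_delta_derivative T (\<lambda>r. exp (F r)) (of_real (?q t) * exp (F t)) t"
      unfolding conf_exp_def by (rule ts_exp_factorization[OF T q])
    have dE: "has_delta_derivative T (\<lambda>r. exp (F r)) (of_real (?q t) * exp (F t)) t"
      using reg max assms(6) by (intro dF[rule_format] t) auto
    define h where "h = (\<lambda>s. complex_of_real (f s / k0 \<alpha> s) * exp (- F s))"
    have cont: "continuous_on T (\<lambda>s. exp (- F s))" by (intro continuous_intros contF)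
    have "rd_continuous T h"
      unfolding h_def by (intro rd_continuous_mult rd_continuous_of_real fk cont)
    then obtain G where G: "pre_antiderivative T h G"
      "\<forall>t\<in>T. (is_maximum T t \<longrightarrow> continuous (at t within T) h) \<longrightarrow>
        has_delta_derivative T G (h t) t"
      by (rule rd_continuous_antiderivative[OF T])
    have "continuous (at t within T) h" if "is_maximum T t"
      unfolding h_def using max that cont t
      by (intro continuous_mult continuous_of_real) (auto simp: continuous_on_eq_continuous_within)
    then have dG: "has_delta_derivative T G (h t) t" using G(2) t by blast
    let ?I = "\<lambda>r. delta_integral T (\<lambda>s. complex_of_real (f s) *
      conf_exp T k0 k1 \<alpha> (\<lambda>_. 0) r s / complex_of_real (k0 \<alpha> s)) a r"
    \<comment> \<open>The upper limit also occurs in the integrand, but only through the factor \<open>exp (F r)\<close>.\<close>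
    have I: "?I r = (G r - G a) * exp (F r)" if "r \<in> T" for r
    proof -
      have "pre_antiderivative T (\<lambda>s. complex_of_real (f s) *
          conf_exp T k0 k1 \<alpha> (\<lambda>_. 0) r s / complex_of_real (k0 \<alpha> s)) (\<lambda>s. exp (F r) * G s)"
        by (rule pre_antiderivative_transform[OF pre_antiderivative_mult_left[OF G(1)]])
          (simp add: h_def F that)
      from delta_integral_eq[OF T this a(1) that] show ?thesis by (simp add: algebra_simps)
    qed
    have "has_delta_derivative T (\<lambda>r. G r - G a) (h t) t"
      using has_delta_derivative_diff[OF t dG has_delta_derivative_const[of T "G a"]] by simp
    from has_delta_derivative_transform[OF T t _ has_delta_derivative_mult[OF t this dE], of ?I]
    have dI: "has_delta_derivative T ?I
        ((G t - G a) * (of_real (?q t) * exp (F t)) + h t * exp (F (fwd_jump T t))) t"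
      by (simp add: I)
    \<comment> \<open>The term \<open>k0 * ?q\<close> that comes from differentiating \<open>exp (F r)\<close> cancels the zeroth-order term
      \<open>k1\<close> of the conformable derivative.\<close>
    have "of_real (k0 \<alpha> t) * complex_of_real (?q t) = - of_real (k1 \<alpha> t)"
      using k0[OF a(2)] by (simp add: conf_quotient_def flip: of_real_mult of_real_minus)
    moreover have "of_real (k0 \<alpha> t) * h t = of_real (f t) * exp (- F t)"
      using k0[OF a(2)] by (simp add: h_def)
    moreover have "of_real (k0 \<alpha> t) * ((G t - G a) * (complex_of_real (?q t) * exp (F t)) +
        h t * exp (F (fwd_jump T t))) =
        (of_real (k0 \<alpha> t) * complex_of_real (?q t)) * ((G t - G a) * exp (F t)) +
        (of_real (k0 \<alpha> t) * h t) * exp (F (fwd_jump T t))"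
      by (simp add: algebra_simps)
    ultimately have "of_real (f t) * (exp (F (fwd_jump T t)) * exp (- F t)) =
        of_real (k1 \<alpha> t) * ((G t - G a) * exp (F t)) +
        of_real (k0 \<alpha> t) * ((G t - G a) * (complex_of_real (?q t) * exp (F t)) +
          h t * exp (F (fwd_jump T t)))"
      by simp
    then show "has_conf_derivative T k0 k1 \<alpha> ?I
          (complex_of_real (f t) * conf_exp T k0 k1 \<alpha> (\<lambda>_. 0) (fwd_jump T t) t) t"
      by (intro has_conf_derivativeI[OF dI])
        (simp add: I[OF t] F fwd_jump_in[OF T t] t scaleR_conv_of_real)
  }
qed

end
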